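(* For any fixed integer $s\geq 2$ and all sufficiently large $t$ (depending on $s$), $$\frac{2^s}{s+1}t-O_s\left(\sqrt{t\ln t}\right)\leq r'_2(K_{s,t})=CR(K_{s,t},K_3)\leq \frac{2^s}{s+1}t+O_s(1).$$ That is, for every integer $s\ge 2$ there exist constants $C_s>0$ and $t_s$ such that for all integers $t\geq t_s$ one has $r'_2(K_{s,t})=CR(K_{s,t},K_3)$ and $\frac{2^s}{s+1}t-C_s\sqrt{t\ln t}\leq r'_2(K_{s,t})\leq \frac{2^s}{s+1}t+C_s$.
   Context: An edge-colored graph $G$ on $p$ vertices with edge-coloring $\chi$ is called orderable if there exist an ordering $(v_1,\ldots,v_p)$ of $V(G)$ and a list $(c_1,\ldots,c_{p-1})$ of not necessarily distinct colors such that for every edge $v_iv_j\in E(G)$ with $i<j$ we have $\chi(v_iv_j)=c_i$. An edge-colored graph is rainbow if all its edges have pairwise different colors. For a graph $G$, $r'_2(G)$ is the minimum integer $n$ such that every 2-edge-coloring of $K_n$ (each edge gets one of two given colors) contains an orderable copy of $G$. For graphs $G,H$, $CR(G,H)$ is the minimum integer $n$ such that every edge-coloring of $K_n$ with any number of colors contains either an orderable copy of $G$ or a rainbow copy of $H$. Copies are (not necessarily induced) subgraphs with the inherited coloring. *)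

theory Defs
  imports Complex_Main "HOL-Library.Ramsey"
begin

record 'a graph =
  verts :: "'a set"
  edges :: "'a set set"

definition simple_graph :: "'a graph \<Rightarrow> bool" where
  "simple_graph G \<longleftrightarrow> finite (verts G) \<and> edges G \<subseteq> [verts G]\<^bsup>2\<^esup>"

definition subgraph_of :: "'a graph \<Rightarrow> 'a graph \<Rightarrow> bool" where
  "subgraph_of H G \<longleftrightarrow> simple_graph H \<and> verts H \<subseteq> verts G \<and> edges H \<subseteq> edges G"

definition graph_iso :: "'a graph \<Rightarrow> 'b graph \<Rightarrow> bool" where
  "graph_iso G H \<longleftrightarrow>
     (\<exists>f. bij_betw f (verts G) (verts H) \<and>
          (\<forall>u\<in>verts G. \<forall>v\<in>verts G. {u, v} \<in> edges G \<longleftrightarrow> {f u, f v} \<in> edges H))"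

definition copy_in :: "'a graph \<Rightarrow> 'b graph \<Rightarrow> 'b graph \<Rightarrow> bool" where
  "copy_in G K H \<longleftrightarrow> subgraph_of H K \<and> graph_iso G H"

definition complete_graph :: "nat \<Rightarrow> nat graph" where
  "complete_graph n = \<lparr>verts = {..<n}, edges = [{..<n}]\<^bsup>2\<^esup>\<rparr>"

definition complete_bipartite :: "nat \<Rightarrow> nat \<Rightarrow> (nat + nat) graph" where
  "complete_bipartite s t =
     \<lparr>verts = {..<s} <+> {..<t}, edges = {{Inl i, Inr j} | i j. i < s \<and> j < t}\<rparr>"

text \<open>An edge-coloring of a graph is a function on sets of vertices, of which only the values on
  edges matter; subgraphs inherit it without change. Lists are indexed from 0, so the color of
  the forward edges at the vertex \<open>vs ! i\<close> is \<open>cs ! i\<close>.\<close>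

definition orderable :: "'a graph \<Rightarrow> ('a set \<Rightarrow> 'c) \<Rightarrow> bool" where
  "orderable G \<chi> \<longleftrightarrow>
     (\<exists>vs cs. distinct vs \<and> set vs = verts G \<and> length cs = length vs - 1 \<and>
        (\<forall>i j. i < j \<and> j < length vs \<and> {vs ! i, vs ! j} \<in> edges G
           \<longrightarrow> \<chi> {vs ! i, vs ! j} = cs ! i))"

definition rainbow :: "'a graph \<Rightarrow> ('a set \<Rightarrow> 'c) \<Rightarrow> bool" where
  "rainbow G \<chi> \<longleftrightarrow> inj_on \<chi> (edges G)"

definition r2' :: "'a graph \<Rightarrow> nat" where
  "r2' G = (LEAST n. \<forall>\<chi> :: nat set \<Rightarrow> nat.
     \<chi> ` edges (complete_graph n) \<subseteq> {0, 1} \<longrightarrow>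
     (\<exists>H. copy_in G (complete_graph n) H \<and> orderable H \<chi>))"

text \<open>Since a complete graph has finitely many edges, natural numbers are enough to name any
  number of colors.\<close>

definition CR :: "'a graph \<Rightarrow> 'b graph \<Rightarrow> nat" where
  "CR G H = (LEAST n. \<forall>\<chi> :: nat set \<Rightarrow> nat.
     (\<exists>G'. copy_in G (complete_graph n) G' \<and> orderable G' \<chi>) \<or>
     (\<exists>H'. copy_in H (complete_graph n) H' \<and> rainbow H' \<chi>))"

lemma simple_graph_complete_graph: "simple_graph (complete_graph n)"
  by (simp add: simple_graph_def complete_graph_def)

lemma simple_graph_complete_bipartite: "simple_graph (complete_bipartite s t)"
  by (auto simp: simple_graph_def complete_bipartite_def nsets_def card_insert_if)

end

theory Submission
  imports Defs
begin

text \<open>An orderable copy of $K_{s,t}$ is an ordered \<open>s\<close>-tuple with prescribed forward colors for which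
  at least \<open>t\<close> further vertices are good; in two colors, exactly \<open>s + 1\<close> of the \<open>2\<^sup>s\<close> color patterns of
  a vertex are good. A union bound for a random coloring gives the lower bound. For the upper bound,
  averaging over tuples and forward colors, convexity (Bernoulli's inequality) shows that every vertex
  is good with probability at least \<open>(s + 1)/2\<^sup>s - O(1/n)\<close>.

  A coloring without rainbow triangles that uses three colors has a homogeneous set by Gallai's theorem.
  An outside vertex of a large homogeneous set, or two twins in a small one, can be put into the
  \<open>s\<close>-tuple to raise the average to \<open>2s/2\<^sup>s\<close>, so such colorings contain a copy already well below the
  threshold. Hence only 2-colorings matter and the two numbers agree.\<close>

subsection \<open>Orderable copies of a complete bipartite graph\<close>

text \<open>The exact value of \<open>r2'\<close> is never determined. To show that
  \<open>CR\<close> equals it, colorings with at least three colors must contain a copy already on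
  \<open>r2'\<close> vertices, and all that is known of this number from below is the bound with an
  error of order \<open>sqrt (t * ln t)\<close>. Such colorings are therefore shown to have a
  surplus linear in the number of vertices, which absorbs any sublinear deficit; this is the term
  \<open>card V / (8 * s ^ 3)\<close>.

  The surplus is delicate for twins. A vertex biased against the color that it sends to the twins
  has a smaller twin average, possibly below the plain one; but a bias \<omega> also raises the
  plain average, by the square of \<omega>. A weighted sum of both averages stays bounded away from
  \<open>s + 1\<close> for every bias.

  Gallai's theorem enters twice: it yields homogeneous sets, and it shows that inside a minimal
  large one all but boundedly many edges at each vertex use two colors, so that the two-color
  counting survives with a bounded error.\<close>

text \<open>If an ordering places \<open>b\<close> between the \<open>j\<close>-th and the next vertex of the \<open>s\<close>-side
  \<open>as\<close>, then the colors \<open>xs\<close> from \<open>b\<close> to \<open>as\<close> agree with the forward colors \<open>cs\<close> of \<open>as\<close> up to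
  \<open>j\<close> and are constant from there on.\<close>

fun good :: "'c list \<Rightarrow> 'c list \<Rightarrow> bool" where
  "good [] [] \<longleftrightarrow> True"
| "good (c # cs) (x # xs) \<longleftrightarrow>
     (if x = c then good cs xs else length cs = length xs \<and> (\<forall>y\<in>set xs. y = x))"
| "good _ _ \<longleftrightarrow> False"

lemma good_length: "good cs xs \<Longrightarrow> length cs = length xs"
  by (induction cs xs rule: good.induct) (auto split: if_splits)

lemma good_const: "length cs = length xs \<Longrightarrow> (\<And>y. y \<in> set xs \<Longrightarrow> y = z) \<Longrightarrow> good cs xs"
  by (induction cs xs rule: good.induct) auto

text \<open>A forward color outside \<open>K\<close> is never matched, so the pattern is constant
  from there on, and a constant tail is good for every list. Hence a union bound over lists with
  entries in \<open>K\<close> covers all forward colors.\<close>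

lemma good_clamp:
  assumes "good cs xs" "set xs \<subseteq> K" "k \<in> K"
  shows "good (map (\<lambda>c. if c \<in> K then c else k) cs) xs"
  using assms
proof (induction cs xs rule: good.induct)
  case (2 c cs x xs)
  then show ?case
    by (auto split: if_splits intro!: good_const)
qed auto

definition pattern :: "('a set \<Rightarrow> 'c) \<Rightarrow> 'a list \<Rightarrow> 'a \<Rightarrow> 'c list" where
  "pattern \<chi> as b = map (\<lambda>a. \<chi> {b, a}) as"

lemma pattern_simps [simp]:
  "pattern \<chi> [] b = []"
  "pattern \<chi> (a # as) b = \<chi> {b, a} # pattern \<chi> as b"
  "pattern \<chi> (as @ us) b = pattern \<chi> as b @ pattern \<chi> us b"
  "length (pattern \<chi> as b) = length as"
  "set (pattern \<chi> as b) = (\<lambda>a. \<chi> {b, a}) ` set as"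
  by (auto simp: pattern_def)

definition good_for :: "('a set \<Rightarrow> 'c) \<Rightarrow> 'a set \<Rightarrow> 'a list \<Rightarrow> 'c list \<Rightarrow> 'a set" where
  "good_for \<chi> V as cs = {b \<in> V - set as. good cs (pattern \<chi> as b)}"

lemma finite_good_for: "finite V \<Longrightarrow> finite (good_for \<chi> V as cs)"
  by (simp add: good_for_def)

text \<open>The order of \<open>as\<close> is the order of the \<open>s\<close>-side within the
  ordering of the copy. The length of \<open>cs\<close> is enforced by \<open>good\<close> as soon
  as one good vertex exists.\<close>

definition has_ordered_biclique :: "'a set \<Rightarrow> ('a set \<Rightarrow> 'c) \<Rightarrow> nat \<Rightarrow> nat \<Rightarrow> bool" where
  "has_ordered_biclique V \<chi> s t \<longleftrightarrow>
     (\<exists>as cs. distinct as \<and> set as \<subseteq> V \<and> length as = s \<and> t \<le> card (good_for \<chi> V as cs))"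

lemma has_ordered_biclique_mono:
  assumes "has_ordered_biclique V \<chi> s t" "V \<subseteq> V'" "finite V'"
  shows "has_ordered_biclique V' \<chi> s t"
proof -
  obtain as cs where *: "distinct as" "set as \<subseteq> V" "length as = s" "t \<le> card (good_for \<chi> V as cs)"
    using assms(1) by (auto simp: has_ordered_biclique_def)
  have "card (good_for \<chi> V as cs) \<le> card (good_for \<chi> V' as cs)"
    using assms by (intro card_mono) (auto simp: good_for_def)
  then show ?thesis
    using * assms unfolding has_ordered_biclique_def by (intro exI[of _ as] exI[of _ cs]) auto
qed

text \<open>An index-free form of the condition in \<open>orderable\<close>, so that orderings can
  be taken apart and built by induction from the front.\<close>

fun forward_mono :: "'a set set \<Rightarrow> ('a set \<Rightarrow> 'c) \<Rightarrow> 'a list \<Rightarrow> bool" where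
  "forward_mono E \<chi> [] \<longleftrightarrow> True"
| "forward_mono E \<chi> (v # vs) \<longleftrightarrow>
     (\<exists>c. \<forall>w\<in>set vs. {v, w} \<in> E \<longrightarrow> \<chi> {v, w} = c) \<and> forward_mono E \<chi> vs"

lemma forward_mono_iff:
  "forward_mono E \<chi> vs \<longleftrightarrow>
     (\<exists>f. \<forall>i j. i < j \<and> j < length vs \<and> {vs ! i, vs ! j} \<in> E \<longrightarrow> \<chi> {vs ! i, vs ! j} = f i)"
proof (induction vs)
  case (Cons v vs)
  show ?case
  proof
    assume "forward_mono E \<chi> (v # vs)"
    then obtain c where c: "\<forall>w\<in>set vs. {v, w} \<in> E \<longrightarrow> \<chi> {v, w} = c"
      and "forward_mono E \<chi> vs"
      unfolding forward_mono.simps by (elim conjE exE)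
    then obtain f where
      f: "\<forall>i j. i < j \<and> j < length vs \<and> {vs ! i, vs ! j} \<in> E \<longrightarrow> \<chi> {vs ! i, vs ! j} = f i"
      unfolding Cons by (elim exE)
    have "\<chi> {(v # vs) ! i, (v # vs) ! j} = case_nat c f i"
      if "i < j" "j < length (v # vs)" "{(v # vs) ! i, (v # vs) ! j} \<in> E" for i j
    proof -
      have "\<exists>j'. j = Suc j'" using that(1) by (cases j) auto
      then obtain j' where j: "j = Suc j'" ..
      show ?thesis
        using that c f j by (cases i) auto
    qed
    then show "\<exists>f. \<forall>i j. i < j \<and> j < length (v # vs) \<and> {(v # vs) ! i, (v # vs) ! j} \<in> E
        \<longrightarrow> \<chi> {(v # vs) ! i, (v # vs) ! j} = f i"
      by blast
  next
    assume "\<exists>f. \<forall>i j. i < j \<and> j < length (v # vs) \<and> {(v # vs) ! i, (v # vs) ! j} \<in> E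
        \<longrightarrow> \<chi> {(v # vs) ! i, (v # vs) ! j} = f i"
    then obtain f where f: "\<And>i j. i < j \<Longrightarrow> j < length (v # vs) \<Longrightarrow>
        {(v # vs) ! i, (v # vs) ! j} \<in> E \<Longrightarrow> \<chi> {(v # vs) ! i, (v # vs) ! j} = f i"
      by blast
    have "\<forall>w\<in>set vs. {v, w} \<in> E \<longrightarrow> \<chi> {v, w} = f 0"
      using f[of 0 "Suc _"] by (auto simp: in_set_conv_nth)
    moreover have "forward_mono E \<chi> vs"
      unfolding Cons using f[of "Suc _" "Suc _"] by (intro exI[of _ "\<lambda>i. f (Suc i)"]) auto
    ultimately show "forward_mono E \<chi> (v # vs)" by auto
  qed
qed auto

lemma orderable_iff:
  "orderable G \<chi> \<longleftrightarrow> (\<exists>vs. distinct vs \<and> set vs = verts G \<and> forward_mono (edges G) \<chi> vs)"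
proof
  assume "orderable G \<chi>"
  then show "\<exists>vs. distinct vs \<and> set vs = verts G \<and> forward_mono (edges G) \<chi> vs"
    unfolding orderable_def forward_mono_iff by blast
next
  assume "\<exists>vs. distinct vs \<and> set vs = verts G \<and> forward_mono (edges G) \<chi> vs"
  then obtain vs f where vs: "distinct vs" "set vs = verts G"
    and f: "\<And>i j. i < j \<and> j < length vs \<and> {vs ! i, vs ! j} \<in> edges G \<longrightarrow> \<chi> {vs ! i, vs ! j} = f i"
    unfolding forward_mono_iff by blast
  show "orderable G \<chi>"
    unfolding orderable_def
    by (rule exI[of _ vs], rule exI[of _ "map f [0..<length vs - 1]"]) (use vs f in auto)
qed

text \<open>The first vertex of the ordering decides. If it lies in \<open>A\<close>, all later
  vertices of \<open>B\<close> see its forward color, which is prepended to \<open>cs\<close>. If it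
  lies in \<open>B\<close>, it has one color to all of \<open>A\<close> still to come, and a
  constant pattern is good for every list.\<close>

lemma forward_mono_imp_good:
  assumes "forward_mono E \<chi> vs" "distinct vs" "A \<inter> B = {}"
    and "\<And>a b. a \<in> A \<Longrightarrow> b \<in> B \<Longrightarrow> {a, b} \<in> E"
  shows "\<exists>cs. length cs = length (filter (\<lambda>v. v \<in> A) vs) \<and>
    (\<forall>b\<in>set vs \<inter> B. good cs (pattern \<chi> (filter (\<lambda>v. v \<in> A) vs) b))"
  using assms(1,2)
proof (induction vs)
  case (Cons v vs)
  let ?as = "filter (\<lambda>v. v \<in> A) vs"
  obtain c where c: "\<And>w. w \<in> set vs \<Longrightarrow> {v, w} \<in> E \<Longrightarrow> \<chi> {v, w} = c"
    using Cons.prems by auto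
  obtain cs where cs: "length cs = length ?as" "\<And>b. b \<in> set vs \<inter> B \<Longrightarrow> good cs (pattern \<chi> ?as b)"
    using Cons by auto
  show ?case
  proof (cases "v \<in> A")
    case True
    have "good (c # cs) (pattern \<chi> (v # ?as) b)" if "b \<in> set vs \<inter> B" for b
    proof -
      have "\<chi> {b, v} = c"
        using c[of b] assms(4)[of v b] True that by (simp add: insert_commute)
      then show ?thesis using cs that by simp
    qed
    moreover have "v \<notin> B" using True assms(3) by auto
    ultimately show ?thesis
      using True cs(1) by (intro exI[of _ "c # cs"]) auto
  next
    case False
    have "good cs (pattern \<chi> ?as v)" if "v \<in> B"
    proof (rule good_const[where z = c])
      fix y assume "y \<in> set (pattern \<chi> ?as v)"
      then obtain a where "a \<in> set vs" "a \<in> A" "y = \<chi> {v, a}" by auto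
      then show "y = c" using c[of a] assms(4)[of a v] that by (simp add: insert_commute)
    qed (use cs in simp)
    then show ?thesis
      using False cs by (intro exI[of _ cs]) auto
  qed
qed auto

text \<open>Vertices with a constant pattern on \<open>a # as\<close> can stand in front of
  \<open>a\<close>. A good pattern that is not constant starts with \<open>hd cs\<close>, so
  \<open>a\<close> has a single color to all vertices of \<open>B\<close> that remain, and the
  recursion continues with \<open>tl cs\<close>.\<close>

lemma good_imp_forward_mono:
  assumes "distinct as" "finite B" "set as \<inter> B = {}" "\<And>b. b \<in> B \<Longrightarrow> good cs (pattern \<chi> as b)"
  shows "\<exists>vs. distinct vs \<and> set vs = set as \<union> B \<and>
    forward_mono {{a, b} | a b. a \<in> set as \<and> b \<in> B} \<chi> vs"
  using assms
proof (induction as arbitrary: B cs)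
  case Nil
  obtain vs where "distinct vs" "set vs = B"
    using finite_distinct_list[OF Nil(2)] by blast
  moreover have "forward_mono {} \<chi> vs" for vs
    by (induction vs) auto
  ultimately show ?case by auto
next
  case (Cons a as)
  define B1 where "B1 = {b \<in> B. \<exists>c. \<forall>a'\<in>insert a (set as). \<chi> {b, a'} = c}"
  define B2 where "B2 = B - B1"
  let ?E = "{{a', b} | a' b. a' \<in> set (a # as) \<and> b \<in> B}"
  let ?E2 = "{{a', b} | a' b. a' \<in> set as \<and> b \<in> B2}"
  have hd: "\<chi> {b, a} = hd cs \<and> good (tl cs) (pattern \<chi> as b)" if "b \<in> B2" for b
  proof -
    have b: "b \<in> B" "b \<notin> B1" using that by (auto simp: B2_def)
    have g: "good cs (pattern \<chi> (a # as) b)" using Cons.prems b by blast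
    then obtain c cs' where cs: "cs = c # cs'" by (cases cs) auto
    have "\<chi> {b, a} = c"
    proof (rule ccontr)
      assume "\<chi> {b, a} \<noteq> c"
      then have "\<forall>a'\<in>insert a (set as). \<chi> {b, a'} = \<chi> {b, a}" using g cs by auto
      then show False using b by (auto simp: B1_def)
    qed
    then show ?thesis using g cs by simp
  qed
  have "\<exists>vs. distinct vs \<and> set vs = set as \<union> B2 \<and> forward_mono ?E2 \<chi> vs"
    using Cons.prems hd by (intro Cons.IH[where cs = "tl cs"]) (auto simp: B2_def)
  then obtain vs where vs: "distinct vs" "set vs = set as \<union> B2" "forward_mono ?E2 \<chi> vs" by blast
  obtain bs where bs: "distinct bs" "set bs = B1"
    using finite_distinct_list[of B1] Cons.prems(2) by (auto simp: B1_def)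
  \<comment> \<open>Neither \<open>a\<close> nor \<open>B1\<close> meets \<open>set vs\<close>, so
    both edge sets agree there.\<close>
  have "forward_mono ?E \<chi> ws" if "set ws \<subseteq> set vs" "forward_mono ?E2 \<chi> ws" for ws
    using that
  proof (induction ws)
    case (Cons w ws)
    have "{w, x} \<in> ?E2" if "x \<in> set ws" "{w, x} \<in> ?E" for x
      using that Cons.prems(1) Cons.prems vs(2) \<open>distinct (a # as)\<close> \<open>set (a # as) \<inter> B = {}\<close>
      by (auto simp: doubleton_eq_iff B2_def) blast+
    then show ?case using Cons by auto
  qed auto
  then have "forward_mono ?E \<chi> vs" using vs(3) by blast
  moreover have "\<forall>w\<in>set vs. {a, w} \<in> ?E \<longrightarrow> \<chi> {a, w} = hd cs"
  proof (intro ballI impI)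
    fix w assume "w \<in> set vs" "{a, w} \<in> ?E"
    then have "w \<in> B2" using vs(2) Cons.prems by (auto simp: doubleton_eq_iff)
    then show "\<chi> {a, w} = hd cs" using hd[of w] by (simp add: insert_commute)
  qed
  ultimately have 1: "forward_mono ?E \<chi> (a # vs)" by auto
  have "forward_mono ?E \<chi> (ws @ a # vs)" if "set ws \<subseteq> B1" for ws
    using that
  proof (induction ws)
    case (Cons w ws)
    then obtain c where c: "\<forall>a'\<in>insert a (set as). \<chi> {w, a'} = c" by (auto simp: B1_def)
    have "\<chi> {w, x} = c" if "{w, x} \<in> ?E" for x
    proof -
      have "w \<in> B" using Cons.prems by (auto simp: B1_def)
      then have "x \<in> insert a (set as)"
        using that \<open>set (a # as) \<inter> B = {}\<close> by (auto simp: doubleton_eq_iff)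
      then show ?thesis using c by blast
    qed
    then show ?case using Cons by auto
  qed (use 1 in auto)
  then have "forward_mono ?E \<chi> (bs @ a # vs)" using bs by auto
  moreover have "distinct (bs @ a # vs)" "set (bs @ a # vs) = set (a # as) \<union> B"
    using bs vs Cons.prems by (auto simp: B1_def B2_def)
  ultimately show ?case by blast
qed

text \<open>Removes graphs from the problem: the \<open>s\<close>-side is read off in the order of
  the ordering, and conversely any \<open>t\<close> good vertices form the other side.\<close>

lemma copy_complete_bipartite_iff:
  "(\<exists>H. copy_in (complete_bipartite s t) (complete_graph n) H \<and> orderable H \<chi>) \<longleftrightarrow>
    has_ordered_biclique {..<n} \<chi> s t"
proof
  assume "\<exists>H. copy_in (complete_bipartite s t) (complete_graph n) H \<and> orderable H \<chi>"
  then obtain H where "copy_in (complete_bipartite s t) (complete_graph n) H" "orderable H \<chi>"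
    by (elim exE conjE)
  then obtain f vs where H: "verts H \<subseteq> {..<n}"
    and f: "bij_betw f ({..<s} <+> {..<t}) (verts H)"
    and fe: "\<forall>u\<in>verts (complete_bipartite s t). \<forall>v\<in>verts (complete_bipartite s t).
      {u, v} \<in> edges (complete_bipartite s t) \<longleftrightarrow> {f u, f v} \<in> edges H"
    and vs: "distinct vs" "set vs = verts H" "forward_mono (edges H) \<chi> vs"
    unfolding copy_in_def graph_iso_def subgraph_of_def orderable_iff
    by (elim conjE exE) (simp add: complete_bipartite_def complete_graph_def)
  define A where "A = f ` Inl ` {..<s}"
  define B where "B = f ` Inr ` {..<t}"
  have inj: "inj_on f ({..<s} <+> {..<t})" and im: "f ` ({..<s} <+> {..<t}) = verts H"
    using f by (auto simp: bij_betw_def)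
  have AB: "A \<inter> B = {}"
    using inj by (auto simp: A_def B_def inj_on_def)
  have E: "{a, b} \<in> edges H" if "a \<in> A" "b \<in> B" for a b
  proof -
    obtain i j where "i < s" "j < t" "a = f (Inl i)" "b = f (Inr j)"
      using \<open>a \<in> A\<close> \<open>b \<in> B\<close> by (auto simp: A_def B_def)
    then show ?thesis
      using fe[rule_format, of "Inl i" "Inr j"] by (auto simp: complete_bipartite_def)
  qed
  have un: "verts H = A \<union> B"
    unfolding im[symmetric] A_def B_def Plus_def image_Un ..
  have cards: "card A = s" "card B = t"
    unfolding A_def B_def image_image
    by (subst card_image; use inj in \<open>force simp: inj_on_def\<close>)+
  let ?as = "filter (\<lambda>v. v \<in> A) vs"
  obtain cs where cs: "\<And>b. b \<in> set vs \<inter> B \<Longrightarrow> good cs (pattern \<chi> ?as b)"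
    using forward_mono_imp_good[OF vs(3,1) AB E] by blast
  have setas: "set ?as = A" using vs un by auto
  have "B \<subseteq> good_for \<chi> {..<n} ?as cs"
    using cs vs(2) un H AB setas by (auto simp: good_for_def)
  then have "t \<le> card (good_for \<chi> {..<n} ?as cs)"
    using cards card_mono[OF finite_good_for] by blast
  moreover have "length ?as = s"
    using distinct_card[of ?as] vs(1) setas cards by simp
  ultimately show "has_ordered_biclique {..<n} \<chi> s t"
    unfolding has_ordered_biclique_def using vs(1) setas un H by (intro exI[of _ ?as] exI[of _ cs]) auto
next
  assume "has_ordered_biclique {..<n} \<chi> s t"
  then obtain as cs where as: "distinct as" "set as \<subseteq> {..<n}" "length as = s"
    and t: "t \<le> card (good_for \<chi> {..<n} as cs)"
    unfolding has_ordered_biclique_def by blast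
  obtain B where B: "B \<subseteq> good_for \<chi> {..<n} as cs" "card B = t" "finite B"
    using obtain_subset_with_card_n[OF t] by blast
  have disj: "set as \<inter> B = {}" and Bn: "B \<subseteq> {..<n}" and g: "\<And>b. b \<in> B \<Longrightarrow> good cs (pattern \<chi> as b)"
    using B(1) by (auto simp: good_for_def)
  define H where "H = \<lparr>verts = set as \<union> B, edges = {{a, b} | a b. a \<in> set as \<and> b \<in> B}\<rparr>"
  have "orderable H \<chi>"
    using good_imp_forward_mono[OF as(1) B(3) disj g] unfolding orderable_iff H_def by auto
  moreover have "subgraph_of H (complete_graph n)"
    using as(2) Bn B(3) disj
    by (auto simp: subgraph_of_def simple_graph_def H_def complete_graph_def nsets_def card_insert_if)
  moreover have "graph_iso (complete_bipartite s t) H"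
  proof -
    obtain g where g: "bij_betw g {..<t} B"
      using B(2,3) by (metis bij_betw_from_nat_into_finite)
    define f where "f = case_sum (\<lambda>i. as ! i) g"
    have nth: "bij_betw (\<lambda>i. as ! i) {..<s} (set as)"
      using as by (simp add: bij_betw_nth)
    have ga: "as ! i \<in> set as" "as ! i \<notin> B" if "i < s" for i
      using nth_mem[of i as] that as disj by blast+
    have gb: "g j \<in> B" "g j \<notin> set as" if "j < t" for j
      using that g disj by (auto simp: bij_betw_def)
    have inj: "inj_on f ({..<s} <+> {..<t})"
      using nth g ga gb unfolding inj_on_def f_def bij_betw_def
      by (auto simp: inj_on_def) (metis+)
    moreover have "f ` ({..<s} <+> {..<t}) = set as \<union> B"
      using nth g unfolding f_def bij_betw_def by (force simp: image_Un Plus_def image_image)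
    moreover have "{u, v} \<in> edges (complete_bipartite s t) \<longleftrightarrow> {f u, f v} \<in> edges H"
      if "u \<in> {..<s} <+> {..<t}" "v \<in> {..<s} <+> {..<t}" for u v
      using that ga gb
      by (auto simp: complete_bipartite_def H_def f_def doubleton_eq_iff; blast)
    ultimately show ?thesis
      unfolding graph_iso_def
      by (intro exI[of _ f]) (auto simp: bij_betw_def complete_bipartite_def H_def)
  qed
  ultimately show "\<exists>H. copy_in (complete_bipartite s t) (complete_graph n) H \<and> orderable H \<chi>"
    unfolding copy_in_def by blast
qed

subsection \<open>Colorings without rainbow triangles\<close>

definition rainbow_triangle_free :: "'a set \<Rightarrow> ('a set \<Rightarrow> 'c) \<Rightarrow> bool" where
  "rainbow_triangle_free V \<chi> \<longleftrightarrow>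
     (\<forall>x\<in>V. \<forall>y\<in>V. \<forall>z\<in>V. x \<noteq> y \<and> y \<noteq> z \<and> x \<noteq> z \<longrightarrow>
        \<chi> {x, y} = \<chi> {y, z} \<or> \<chi> {y, z} = \<chi> {x, z} \<or> \<chi> {x, y} = \<chi> {x, z})"

text \<open>\<open>X\<close> is a union of connected components of the graph on \<open>U\<close>
  formed by the edges with colors in \<open>L\<close>.\<close>

definition closed_under :: "('a set \<Rightarrow> 'c) \<Rightarrow> 'c set \<Rightarrow> 'a set \<Rightarrow> 'a set \<Rightarrow> bool" where
  "closed_under \<chi> L U X \<longleftrightarrow> X \<subseteq> U \<and> (\<forall>x\<in>X. \<forall>y\<in>U - X. \<chi> {x, y} \<notin> L)"

definition color_connected :: "('a set \<Rightarrow> 'c) \<Rightarrow> 'c set \<Rightarrow> 'a set \<Rightarrow> bool" where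
  "color_connected \<chi> L U \<longleftrightarrow> (\<forall>X. closed_under \<chi> L U X \<longrightarrow> X = {} \<or> X = U)"

text \<open>A module in the sense of modular decomposition, for edge colors in place of
  adjacency.\<close>

definition homogeneous :: "('a set \<Rightarrow> 'c) \<Rightarrow> 'a set \<Rightarrow> 'a set \<Rightarrow> bool" where
  "homogeneous \<chi> U X \<longleftrightarrow> X \<subseteq> U \<and> (\<forall>w\<in>U - X. \<exists>c. \<forall>x\<in>X. \<chi> {w, x} = c)"

text \<open>For \<open>u\<close> in \<open>U\<close>, the connected component of \<open>u\<close> as
  the least closed set, which avoids paths.\<close>

definition component :: "('a set \<Rightarrow> 'c) \<Rightarrow> 'c set \<Rightarrow> 'a set \<Rightarrow> 'a \<Rightarrow> 'a set" where
  "component \<chi> L U u = \<Inter>{X. closed_under \<chi> L U X \<and> u \<in> X}"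

lemma rainbow_triangle_freeD:
  assumes "rainbow_triangle_free V \<chi>" "x \<in> V" "y \<in> V" "z \<in> V" "x \<noteq> y" "y \<noteq> z" "x \<noteq> z"
  shows "\<chi> {x, y} = \<chi> {y, z} \<or> \<chi> {y, z} = \<chi> {x, z} \<or> \<chi> {x, y} = \<chi> {x, z}"
  using assms unfolding rainbow_triangle_free_def by blast

lemma rainbow_triangle_free_subset:
  "rainbow_triangle_free V \<chi> \<Longrightarrow> U \<subseteq> V \<Longrightarrow> rainbow_triangle_free U \<chi>"
  unfolding rainbow_triangle_free_def by blast

lemma closed_underD:
  assumes "closed_under \<chi> L U X" "x \<in> X" "y \<in> U" "y \<notin> X"
  shows "\<chi> {x, y} \<notin> L" "\<chi> {y, x} \<notin> L"
  using assms by (auto simp: closed_under_def insert_commute[of y x])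

lemma closed_under_Diff:
  assumes "closed_under \<chi> L U X" "closed_under \<chi> L U Y"
  shows "closed_under \<chi> L U (X - Y)"
  unfolding closed_under_def
proof (intro conjI ballI)
  show "X - Y \<subseteq> U" using assms by (auto simp: closed_under_def)
  fix x y assume "x \<in> X - Y" "y \<in> U - (X - Y)"
  then show "\<chi> {x, y} \<notin> L"
    using closed_underD(1)[OF assms(1), of x y] closed_underD(2)[OF assms(2), of y x] assms
    by (auto simp: closed_under_def)
qed

lemma closed_under_self: "closed_under \<chi> L U U"
  by (auto simp: closed_under_def)

lemma component_self: "u \<in> component \<chi> L U u"
  by (auto simp: component_def)

lemma component_closed:
  assumes "u \<in> U"
  shows "closed_under \<chi> L U (component \<chi> L U u)"
  unfolding closed_under_def
proof (intro conjI ballI)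
  show "component \<chi> L U u \<subseteq> U"
    using closed_under_self[of \<chi> L U] assms by (auto simp: component_def)
  fix x y assume x: "x \<in> component \<chi> L U u" and y: "y \<in> U - component \<chi> L U u"
  then obtain X where "closed_under \<chi> L U X" "u \<in> X" "y \<notin> X"
    by (auto simp: component_def)
  then show "\<chi> {x, y} \<notin> L"
    using x y by (auto simp: component_def closed_under_def)
qed

text \<open>If \<open>X\<close> missed \<open>u\<close>, removing it would leave a smaller closed
  set around \<open>u\<close>. This is the connectedness of components.\<close>

lemma component_minimal:
  assumes "closed_under \<chi> L U X" "X \<noteq> {}" "X \<subseteq> component \<chi> L U u" "u \<in> U"
  shows "X = component \<chi> L U u"
proof (cases "u \<in> X")
  case True
  then show ?thesis using assms by (auto simp: component_def)
next
  case False
  have "closed_under \<chi> L U (component \<chi> L U u - X)"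
    using component_closed[OF assms(4)] assms(1) by (intro closed_under_Diff) auto
  then have "component \<chi> L U u \<subseteq> component \<chi> L U u - X"
    using False component_self[of u \<chi> L U] by (subst component_def) blast
  then show ?thesis using assms by blast
qed

text \<open>All edges from an outside vertex \<open>w\<close> to the component have colors outside
  \<open>L\<close>. If \<open>w\<close> had different colors to the two ends of an edge with color
  in \<open>L\<close>, the triangle would be rainbow; so the vertices on which \<open>w\<close> has
  the same color as on \<open>u\<close> form a closed set.\<close>

lemma component_homogeneous:
  assumes "rainbow_triangle_free U \<chi>" "u \<in> U"
  shows "homogeneous \<chi> U (component \<chi> L U u)"
  unfolding homogeneous_def
proof (intro conjI ballI)
  let ?X = "component \<chi> L U u"
  have cl: "closed_under \<chi> L U ?X" using component_closed[OF assms(2)] .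
  then show sub: "?X \<subseteq> U" by (auto simp: closed_under_def)
  fix w assume w: "w \<in> U - ?X"
  define Y where "Y = {x \<in> ?X. \<chi> {w, x} = \<chi> {w, u}}"
  have "closed_under \<chi> L U Y"
    unfolding closed_under_def
  proof (intro conjI ballI)
    show "Y \<subseteq> U" using sub by (auto simp: Y_def)
    fix x y assume x: "x \<in> Y" and y: "y \<in> U - Y"
    show "\<chi> {x, y} \<notin> L"
    proof (cases "y \<in> ?X")
      case True
      have "\<chi> {w, x} \<notin> L" "\<chi> {w, y} \<notin> L"
        using closed_underD(2)[OF cl, of x w] closed_underD(2)[OF cl, of y w] w x True
        by (auto simp: Y_def)
      moreover have ne: "\<chi> {w, x} \<noteq> \<chi> {w, y}" using x y True by (auto simp: Y_def)
      moreover have "x \<in> U" "w \<noteq> x" "w \<noteq> y" "x \<noteq> y"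
        using x w sub True ne by (auto simp: Y_def)
      ultimately show ?thesis
        using rainbow_triangle_freeD[OF assms(1), of w x y] w y by auto
    qed (use cl x y in \<open>auto simp: closed_under_def Y_def\<close>)
  qed
  moreover have "u \<in> Y" using component_self by (auto simp: Y_def)
  ultimately have "Y = ?X"
    using assms(2) by (intro component_minimal) (auto simp: Y_def)
  then show "\<exists>c. \<forall>x\<in>?X. \<chi> {w, x} = c" by (auto simp: Y_def)
qed

text \<open>If \<open>L1\<close> fell apart without \<open>v\<close>, then \<open>v\<close> would
  have an edge with color in \<open>L1\<close> into every component. Together with neighbours
  \<open>y\<close> and \<open>z\<close> of \<open>v\<close> in colors of \<open>L2\<close> and
  \<open>L3\<close>, homogeneity of the components forces a color of \<open>L2\<close> to equal one
  of \<open>L3\<close>.\<close>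

lemma three_connected_step:
  assumes free: "rainbow_triangle_free V \<chi>" and v: "v \<in> V"
    and con: "color_connected \<chi> L1 V" "color_connected \<chi> L2 V" "color_connected \<chi> L3 V"
    and disj: "L1 \<inter> L2 = {}" "L1 \<inter> L3 = {}" "L2 \<inter> L3 = {}"
    and ne: "V - {v} \<noteq> {}"
  shows "color_connected \<chi> L1 (V - {v})"
proof (rule ccontr)
  let ?U = "V - {v}"
  let ?C = "component \<chi> L1 ?U"
  assume "\<not> color_connected \<chi> L1 ?U"
  then obtain X where X: "closed_under \<chi> L1 ?U X" "X \<noteq> {}" "X \<noteq> ?U"
    by (auto simp: color_connected_def)
  have freeU: "rainbow_triangle_free ?U \<chi>" using rainbow_triangle_free_subset[OF free] by blast
  have ex: "\<exists>y\<in>?U. \<chi> {v, y} \<in> L" if "color_connected \<chi> L V" for L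
  proof (rule ccontr)
    assume "\<not> ?thesis"
    then have "closed_under \<chi> L V {v}" using v by (auto simp: closed_under_def)
    then show False using that ne v unfolding color_connected_def by blast
  qed
  have ex1: "\<exists>x\<in>Y. \<chi> {v, x} \<in> L1" if "closed_under \<chi> L1 ?U Y" "Y \<noteq> {}" for Y
  proof (rule ccontr)
    assume *: "\<not> ?thesis"
    have "closed_under \<chi> L1 V Y"
      unfolding closed_under_def
    proof (intro conjI ballI)
      show "Y \<subseteq> V" using that by (auto simp: closed_under_def)
      fix x y assume "x \<in> Y" "y \<in> V - Y"
      then show "\<chi> {x, y} \<notin> L1"
        using that * by (cases "y = v") (auto simp: closed_under_def insert_commute)
    qed
    then have "Y = V" using con that unfolding color_connected_def by blast
    then show False using that v by (auto simp: closed_under_def)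
  qed
  \<comment> \<open>In the triangle on \<open>v\<close>, \<open>y\<close>, \<open>x\<close> only
    \<open>{v, x}\<close> has a color in \<open>L1\<close>, so the other two edges must
    agree.\<close>
  have transfer: "\<chi> {y, x} = \<chi> {v, y}"
    if "y \<in> ?U" "\<chi> {v, y} \<notin> L1" "x \<in> ?U - ?C y" "\<chi> {v, x} \<in> L1" for x y
  proof -
    have "\<chi> {y, x} \<notin> L1"
      using component_closed[OF that(1), of \<chi> L1] component_self[of y \<chi> L1 ?U] that(3)
      by (auto simp: closed_under_def)
    moreover have "x \<noteq> y" using that(3) component_self[of y \<chi> L1 ?U] by auto
    ultimately show ?thesis
      using rainbow_triangle_freeD[OF free, of v y x] that v by auto
  qed
  have hom: "\<chi> {w, x} = \<chi> {w, x'}" if "u \<in> ?U" "w \<in> ?U - ?C u" "x \<in> ?C u" "x' \<in> ?C u" for u w x x'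
    using component_homogeneous[OF freeU that(1), of L1] that(2-4) unfolding homogeneous_def
    by metis
  obtain y where y: "y \<in> ?U" "\<chi> {v, y} \<in> L2" using ex[OF con(2)] by blast
  obtain z where z: "z \<in> ?U" "\<chi> {v, z} \<in> L3" using ex[OF con(3)] by blast
  have yz: "\<chi> {v, y} \<notin> L1" "\<chi> {v, z} \<notin> L1" using y z disj by auto
  show False
  proof (cases "z \<in> ?C y")
    case True
    have Cy: "closed_under \<chi> L1 ?U (?C y)" using component_closed[OF y(1)] .
    have "?C y \<noteq> ?U"
    proof
      assume "?C y = ?U"
      then show False
        using component_minimal[OF X(1,2) _ y(1)] X(1,3) by (auto simp: closed_under_def)
    qed
    then have "?U - ?C y \<noteq> {}" using Cy by (auto simp: closed_under_def)
    moreover have "closed_under \<chi> L1 ?U (?U - ?C y)"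
      using Cy closed_under_self by (rule closed_under_Diff[rotated])
    ultimately obtain x where x: "x \<in> ?U - ?C y" "\<chi> {v, x} \<in> L1" using ex1 by blast
    have Cz: "?C z \<subseteq> ?C y"
      using True Cy by (subst component_def) blast
    have "\<chi> {y, x} = \<chi> {v, y}" "\<chi> {z, x} = \<chi> {v, z}"
      using transfer[OF y(1) yz(1) x] transfer[OF z(1) yz(2) _ x(2)] x(1) Cz by auto
    moreover have "\<chi> {x, y} = \<chi> {x, z}"
      using hom[OF y(1) x(1) component_self True] .
    ultimately show False using y z disj by (auto simp: insert_commute)
  next
    case False
    have notin: "y \<notin> ?C z"
    proof
      assume "y \<in> ?C z"
      then have "?C y \<subseteq> ?C z"
        using component_closed[OF z(1), of \<chi> L1] by (subst component_def) blast
      then have "?C y = ?C z"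
        using component_closed[OF y(1), of \<chi> L1] component_self[of y \<chi> L1 ?U] z(1)
        by (intro component_minimal) auto
      then show False using False component_self[of z \<chi> L1 ?U] by auto
    qed
    have disjC: "?C y \<inter> ?C z = {}"
    proof (rule ccontr)
      assume *: "?C y \<inter> ?C z \<noteq> {}"
      have "?C y \<inter> ?C z = ?C y - (?C y - ?C z)" by blast
      moreover have "closed_under \<chi> L1 ?U (?C y - (?C y - ?C z))"
        using component_closed[OF y(1), of \<chi> L1] component_closed[OF z(1), of \<chi> L1]
        by (intro closed_under_Diff)
      ultimately have cl: "closed_under \<chi> L1 ?U (?C y \<inter> ?C z)" by simp
      have "?C y \<inter> ?C z = ?C y"
        using component_minimal[OF cl * _ y(1)] by blast
      then show False using notin component_self[of y \<chi> L1 ?U] by blast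
    qed
    obtain x where x: "x \<in> ?C z" "\<chi> {v, x} \<in> L1"
      using ex1[OF component_closed[OF z(1)]] component_self[of z \<chi> L1 ?U] by blast
    obtain x' where x': "x' \<in> ?C y" "\<chi> {v, x'} \<in> L1"
      using ex1[OF component_closed[OF y(1)]] component_self[of y \<chi> L1 ?U] by blast
    have sub: "?C y \<subseteq> ?U" "?C z \<subseteq> ?U"
      using component_closed[OF y(1), of \<chi> L1] component_closed[OF z(1), of \<chi> L1]
      by (auto simp: closed_under_def)
    have "\<chi> {y, x} = \<chi> {v, y}" "\<chi> {z, x'} = \<chi> {v, z}"
      using transfer[OF y(1) yz(1) _ x(2)] transfer[OF z(1) yz(2) _ x'(2)] x(1) x'(1) sub disjC
      by auto
    \<comment> \<open>Homogeneity of both components carries the two transferred colors to the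
      single edge \<open>{y, z}\<close>.\<close>
    moreover have "\<chi> {y, x} = \<chi> {y, z}"
      using hom[OF z(1) _ x(1) component_self] y(1) notin by auto
    moreover have "\<chi> {z, x'} = \<chi> {z, y}"
      using hom[OF y(1) _ x'(1) component_self] z(1) False by auto
    ultimately show False using y z disj by (auto simp: insert_commute)
  qed
qed

text \<open>Gallai's theorem, for unions of color classes.\<close>

lemma not_three_connected:
  assumes "finite V" "card V \<ge> 2" "rainbow_triangle_free V \<chi>"
    and "L1 \<inter> L2 = {}" "L1 \<inter> L3 = {}" "L2 \<inter> L3 = {}"
  shows "\<not> (color_connected \<chi> L1 V \<and> color_connected \<chi> L2 V \<and> color_connected \<chi> L3 V)"
  using assms(1-3)
proof (induction "card V" arbitrary: V rule: less_induct)
  case less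
  show ?case
  proof
    assume con: "color_connected \<chi> L1 V \<and> color_connected \<chi> L2 V \<and> color_connected \<chi> L3 V"
    obtain v where v: "v \<in> V" using less.prems by fastforce
    have ne: "V - {v} \<noteq> {}"
    proof
      assume "V - {v} = {}"
      then have "V = {v}" using v by blast
      then show False using less.prems(2) by simp
    qed
    have con': "color_connected \<chi> L1 (V - {v})" "color_connected \<chi> L2 (V - {v})"
      "color_connected \<chi> L3 (V - {v})"
    proof -
      note step = three_connected_step[OF less.prems(3) v _ _ _ _ _ _ ne]
      have c: "color_connected \<chi> L1 V" "color_connected \<chi> L2 V" "color_connected \<chi> L3 V"
        using con by blast+
      have d: "L2 \<inter> L1 = {}" "L3 \<inter> L1 = {}" "L3 \<inter> L2 = {}" using assms(4-6) by blast+
      show "color_connected \<chi> L1 (V - {v})" by (rule step[OF c assms(4-6)])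
      show "color_connected \<chi> L2 (V - {v})" by (rule step[OF c(2,1,3) d(1) assms(6,5)])
      show "color_connected \<chi> L3 (V - {v})" by (rule step[OF c(3,1,2) d(2,3) assms(4)])
    qed
    \<comment> \<open>Neighbours of \<open>v\<close> in colors of \<open>L1\<close> and of
      \<open>L2\<close> are distinct, so at least two vertices remain and the induction hypothesis
      applies.\<close>
    have "\<exists>y\<in>V - {v}. \<chi> {v, y} \<in> L" if "color_connected \<chi> L V" for L
    proof (rule ccontr)
      assume "\<not> ?thesis"
      then have "closed_under \<chi> L V {v}" using v by (auto simp: closed_under_def)
      then show False using that ne v unfolding color_connected_def by blast
    qed
    then obtain y z where "y \<in> V - {v}" "z \<in> V - {v}" "\<chi> {v, y} \<in> L1" "\<chi> {v, z} \<in> L2"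
      using con by meson
    then have "{y, z} \<subseteq> V - {v}" "y \<noteq> z" using assms(4) by auto
    then have "2 \<le> card (V - {v})"
      using card_mono[of "V - {v}" "{y, z}"] less.prems by auto
    then show False
      using less.hyps[of "V - {v}"] less.prems v con'
        rainbow_triangle_free_subset[OF less.prems(3), of "V - {v}"]
      by (metis Diff_subset card_Diff1_less finite_Diff)
  qed
qed

section \<open>Consequences of Gallai's theorem\<close>

lemma homogeneous_trans:
  assumes "homogeneous \<chi> U X" "homogeneous \<chi> X Y"
  shows "homogeneous \<chi> U Y"
  unfolding homogeneous_def
proof (intro conjI ballI)
  show "Y \<subseteq> U" using assms by (auto simp: homogeneous_def)
  fix w assume w: "w \<in> U - Y"
  show "\<exists>c. \<forall>x\<in>Y. \<chi> {w, x} = c"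
  proof (cases "w \<in> X")
    case False
    then obtain c where "\<forall>x\<in>X. \<chi> {w, x} = c"
      using assms(1) w unfolding homogeneous_def by blast
    then show ?thesis using assms(2) by (auto simp: homogeneous_def)
  qed (use assms(2) w in \<open>auto simp: homogeneous_def\<close>)
qed

definition other_degree :: "('a set \<Rightarrow> 'c) \<Rightarrow> 'c set \<Rightarrow> 'a set \<Rightarrow> 'a \<Rightarrow> nat" where
  "other_degree \<chi> L U u = card {w \<in> U. w \<noteq> u \<and> \<chi> {u, w} \<in> L}"

text \<open>A disconnected union of colors has small components, hence small degrees. A minimal connected
  union \<open>L\<close> contains a color \<open>c\<close> with \<open>L - {c}\<close> disconnected; if the complement of \<open>L\<close> is
  connected, it contributes a second color in the same way, and Gallai's theorem bounds the rest.\<close>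

lemma almost_two_colors:
  fixes \<chi> :: "'a set \<Rightarrow> nat"
  assumes fin: "finite U" and card: "card U \<ge> 2" and free: "rainbow_triangle_free U \<chi>"
    and small: "\<And>X. homogeneous \<chi> U X \<Longrightarrow> X \<noteq> U \<Longrightarrow> card X \<le> s"
  shows "\<exists>c1 c2. c1 \<noteq> c2 \<and> (\<forall>u\<in>U. other_degree \<chi> (- {c1, c2}) U u \<le> 3 * s)"
proof -
  define K where "K = \<chi> ` {{x, y} | x y. x \<in> U \<and> y \<in> U}"
  have "{{x, y} | x y. x \<in> U \<and> y \<in> U} \<subseteq> Pow U" by auto
  then have finK: "finite K" unfolding K_def using fin finite_subset by blast
  have deg: "other_degree \<chi> L U u \<le> s" if "\<not> color_connected \<chi> L U" "u \<in> U" for L u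
  proof -
    let ?C = "component \<chi> L U u"
    obtain X where X: "closed_under \<chi> L U X" "X \<noteq> {}" "X \<noteq> U"
      using \<open>\<not> color_connected \<chi> L U\<close> by (auto simp: color_connected_def)
    have cl: "closed_under \<chi> L U ?C" using component_closed[OF that(2)] .
    have "?C \<noteq> U"
      using component_minimal[OF X(1,2) _ that(2)] X(1,3) by (auto simp: closed_under_def)
    then have "card ?C \<le> s" using small component_homogeneous[OF free that(2)] by blast
    moreover have "{w \<in> U. w \<noteq> u \<and> \<chi> {u, w} \<in> L} \<subseteq> ?C"
      using cl component_self[of u \<chi> L U] by (auto simp: closed_under_def)
    moreover have "finite ?C" using cl fin finite_subset by (auto simp: closed_under_def)
    ultimately show ?thesis unfolding other_degree_def using card_mono le_trans by blast
  qed
  have conK: "color_connected \<chi> K U"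
    unfolding color_connected_def
  proof (intro allI impI)
    fix X assume X: "closed_under \<chi> K U X"
    show "X = {} \<or> X = U"
    proof (rule ccontr)
      assume "\<not> ?thesis"
      then obtain x y where "x \<in> X" "y \<in> U - X" using X by (auto simp: closed_under_def)
      then show False using X unfolding closed_under_def K_def by blast
    qed
  qed
  have split: "\<exists>c L. L \<subseteq> M \<and> c \<in> L \<and> color_connected \<chi> L U \<and> \<not> color_connected \<chi> (L - {c}) U"
    if "color_connected \<chi> M U" "finite M" for M
    using that(2,1)
  proof (induction M rule: finite_psubset_induct)
    case (psubset M)
    have "M \<noteq> {}"
    proof
      assume M: "M = {}"
      obtain u where u: "u \<in> U" using card by fastforce
      then have "U = {u}" using psubset.prems M by (auto simp: color_connected_def closed_under_def)
      then have "card U = 1" by simp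
      then show False using card by simp
    qed
    then obtain c where c: "c \<in> M" by blast
    show ?case
    proof (cases "color_connected \<chi> (M - {c}) U")
      case True
      then obtain c' L where "L \<subseteq> M - {c}" "c' \<in> L" "color_connected \<chi> L U"
        "\<not> color_connected \<chi> (L - {c'}) U"
        using psubset.IH[of "M - {c}"] c by blast
      then show ?thesis by blast
    next
      case False
      then show ?thesis using psubset.prems c by blast
    qed
  qed
  obtain c L where L: "L \<subseteq> K" "c \<in> L" "color_connected \<chi> L U" "\<not> color_connected \<chi> (L - {c}) U"
    using split[OF conK finK] by blast
  have Kcol: "\<chi> {u, w} \<in> K" if "u \<in> U" "w \<in> U" for u w
    using that by (auto simp: K_def)
  have degU: "other_degree \<chi> M U u \<le> other_degree \<chi> M1 U u + other_degree \<chi> M2 U u + other_degree \<chi> M3 U u"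
    if "M \<inter> K \<subseteq> M1 \<union> M2 \<union> M3" "u \<in> U" for M M1 M2 M3 u
  proof -
    have "{w \<in> U. w \<noteq> u \<and> \<chi> {u, w} \<in> M} \<subseteq> {w \<in> U. w \<noteq> u \<and> \<chi> {u, w} \<in> M1} \<union>
      {w \<in> U. w \<noteq> u \<and> \<chi> {u, w} \<in> M2} \<union> {w \<in> U. w \<noteq> u \<and> \<chi> {u, w} \<in> M3}" (is "_ \<subseteq> ?R")
      using that Kcol by blast
    then have "other_degree \<chi> M U u \<le> card ?R"
      unfolding other_degree_def using fin by (intro card_mono) auto
    also have "\<dots> \<le> other_degree \<chi> M1 U u + other_degree \<chi> M2 U u + other_degree \<chi> M3 U u"
      unfolding other_degree_def by (meson card_Un_le le_trans add_right_mono)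
    finally show ?thesis .
  qed
  show ?thesis
  proof (cases "color_connected \<chi> (K - L) U")
    case False
    \<comment> \<open>\<open>K - L\<close> already has small degrees as a whole, so any second color
      will do.\<close>
    obtain c' where c': "c' \<noteq> c" by (metis n_not_Suc_n)
    have "other_degree \<chi> (- {c, c'}) U u \<le> 3 * s" if "u \<in> U" for u
      using degU[of "- {c, c'}" "L - {c}" "K - L" "K - L" u] deg[OF L(4) that] deg[OF False that] that
      by force
    then show ?thesis using c' by metis
  next
    case True
    then obtain c' L' where L': "L' \<subseteq> K - L" "c' \<in> L'" "color_connected \<chi> L' U"
      "\<not> color_connected \<chi> (L' - {c'}) U"
      using split finK by (metis finite_Diff)
    \<comment> \<open>\<open>L\<close> and \<open>L'\<close> are connected, hence the remaining
      colors are not; the three disconnected parts contribute at most \<open>s\<close> each.\<close>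
    have F: "\<not> color_connected \<chi> (K - L - L') U"
      using not_three_connected[OF fin card free, of L L' "K - L - L'"] L L' by blast
    have "other_degree \<chi> (- {c, c'}) U u \<le> 3 * s" if "u \<in> U" for u
      using degU[of "- {c, c'}" "L - {c}" "L' - {c'}" "K - L - L'" u]
        deg[OF L(4) that] deg[OF L'(4) that] deg[OF F that] that by force
    moreover have "c \<noteq> c'" using L L' by auto
    ultimately show ?thesis by blast
  qed
qed

text \<open>By Gallai's theorem one of three occurring colors is disconnected. Its component around
  an edge of that color is proper, homogeneous, and contains both ends.\<close>

lemma proper_homogeneous:
  assumes fin: "finite U" and free: "rainbow_triangle_free U \<chi>"
    and sub: "\<not> (\<exists>c c'. \<chi> ` {{x, y} | x y. x \<in> U \<and> y \<in> U \<and> x \<noteq> y} \<subseteq> {c, c'})"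
  shows "\<exists>X. homogeneous \<chi> U X \<and> card X \<ge> 2 \<and> X \<noteq> U"
proof -
  define K where "K = \<chi> ` {{x, y} | x y. x \<in> U \<and> y \<in> U \<and> x \<noteq> y}"
  have "\<not> (\<exists>c c'. K \<subseteq> {c, c'})" using sub by (simp add: K_def)
  then obtain c1 c2 c3 where c: "c1 \<in> K" "c2 \<in> K" "c3 \<in> K" "c1 \<noteq> c2" "c1 \<noteq> c3" "c2 \<noteq> c3"
    by (metis insertCI subsetI)
  obtain x0 y0 where "x0 \<in> U" "y0 \<in> U" "x0 \<noteq> y0" using c(1) by (auto simp: K_def)
  then have "card U \<ge> 2" using card_mono[OF fin, of "{x0, y0}"] by auto
  then have "\<not> (color_connected \<chi> {c1} U \<and> color_connected \<chi> {c2} U \<and> color_connected \<chi> {c3} U)"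
    using c by (intro not_three_connected[OF fin _ free]) auto
  then obtain c where cK: "c \<in> K" and nc: "\<not> color_connected \<chi> {c} U" using c by blast
  obtain x y where xy: "x \<in> U" "y \<in> U" "x \<noteq> y" "\<chi> {x, y} = c" using cK by (auto simp: K_def)
  let ?C = "component \<chi> {c} U x"
  obtain X where X: "closed_under \<chi> {c} U X" "X \<noteq> {}" "X \<noteq> U"
    using nc by (auto simp: color_connected_def)
  have cl: "closed_under \<chi> {c} U ?C" using component_closed[OF xy(1)] .
  have "?C \<noteq> U"
    using component_minimal[OF X(1,2) _ xy(1)] X(1,3) by (auto simp: closed_under_def)
  moreover have "{x, y} \<subseteq> ?C"
    using cl component_self[of x \<chi> "{c}" U] xy by (auto simp: closed_under_def)
  then have "card ?C \<ge> 2"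
    using card_mono[of ?C "{x, y}"] cl finite_subset[OF _ fin, of ?C] xy
    by (simp add: closed_under_def)
  ultimately show ?thesis using component_homogeneous[OF free xy(1)] by blast
qed

subsection \<open>Averaging over tuples\<close>

text \<open>Repetitions are allowed so that sums factor entry by entry;
  \<open>card_not_distinct\<close> pays for this.\<close>

definition tuples :: "'a set \<Rightarrow> nat \<Rightarrow> 'a list set" where
  "tuples U r = {xs. set xs \<subseteq> U \<and> length xs = r}"

lemma finite_tuples [simp]: "finite U \<Longrightarrow> finite (tuples U r)"
  unfolding tuples_def by (rule finite_lists_length_eq)

lemma card_tuples: "finite U \<Longrightarrow> card (tuples U r) = card U ^ r"
  unfolding tuples_def by (rule card_lists_length_eq)

lemma tuples_0 [simp]: "tuples U 0 = {[]}"
  by (auto simp: tuples_def)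

lemma tuples_Suc: "tuples U (Suc r) = (\<lambda>(x, xs). x # xs) ` (U \<times> tuples U r)"
  by (auto simp: tuples_def length_Suc_conv image_iff)

lemma sum_tuples_Suc:
  "(\<Sum>xs\<in>tuples U (Suc r). f xs) = (\<Sum>x\<in>U. \<Sum>xs\<in>tuples U r. f (x # xs))"
  unfolding tuples_Suc
  by (subst sum.reindex) (auto simp: inj_on_def sum.cartesian_product case_prod_beta)

lemma sum_tuples_all:
  assumes "finite U"
  shows "(\<Sum>as\<in>tuples U r. of_bool (\<forall>a\<in>set as. P a) :: real) = real (card {a \<in> U. P a}) ^ r"
proof -
  have "tuples U r \<inter> {as. \<forall>a\<in>set as. P a} = tuples {a \<in> U. P a} r"
    by (auto simp: tuples_def)
  then show ?thesis using assms by (simp add: card_tuples)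
qed

text \<open>The double count as seen from one vertex with colors \<open>col\<close>. The end of the
  tuple may be frozen, with pattern \<open>ys\<close> and forward colors \<open>ds\<close>; this is
  where twins go.\<close>

definition good_count :: "'c set \<Rightarrow> 'a set \<Rightarrow> ('a \<Rightarrow> 'c) \<Rightarrow> 'c list \<Rightarrow> 'c list \<Rightarrow> nat \<Rightarrow> real" where
  "good_count K U col ds ys r =
     (\<Sum>as\<in>tuples U r. \<Sum>cs\<in>tuples K r. of_bool (good (cs @ ds) (map col as @ ys)))"

lemma good_count_le:
  assumes "finite U" "finite K"
  shows "good_count K U col ds ys r \<le> (real (card K) * real (card U)) ^ r"
proof -
  have "good_count K U col ds ys r \<le> (\<Sum>as\<in>tuples U r. \<Sum>cs\<in>tuples K r. 1)"
    unfolding good_count_def by (intro sum_mono) auto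
  also have "\<dots> = (real (card K) * real (card U)) ^ r"
    using assms by (simp add: card_tuples power_mult_distrib)
  finally show ?thesis .
qed

text \<open>Condition on the first entry. If its color is \<open>c1\<close> or \<open>c2\<close>,
  one forward color matches and leaves the count for \<open>r\<close>; the other forces all further
  colors to be the same, with \<open>2 ^ r\<close> free choices of the remaining forward colors.
  Entries of other colors are dropped, hence only an inequality.\<close>

lemma good_count_Suc:
  fixes U :: "'a set" and col :: "'a \<Rightarrow> 'c"
  assumes U: "finite U" and c: "c1 \<noteq> c2" and len: "length ds = length ys"
  defines "d \<equiv> \<lambda>c. real (card {a \<in> U. col a = c})"
  shows "good_count {c1, c2} U col ds ys (Suc r) \<ge>
     (d c1 + d c2) * good_count {c1, c2} U col ds ys r
     + 2 ^ r * (of_bool (\<forall>y\<in>set ys. y = c1) * d c1 ^ Suc r + of_bool (\<forall>y\<in>set ys. y = c2) * d c2 ^ Suc r)"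
proof -
  let ?K = "{c1, c2}"
  define T where "T = (\<lambda>x. \<Sum>as\<in>tuples U r. \<Sum>c\<in>?K. \<Sum>cs\<in>tuples ?K r.
    of_bool (good (c # cs @ ds) (x # map col as @ ys)) :: real)"
  have T: "T x = good_count ?K U col ds ys r + 2 ^ r * of_bool (\<forall>y\<in>set ys. y = x) * d x ^ r"
    if x: "x \<in> ?K" for x
  proof -
    have split: "(\<Sum>c\<in>?K. h c) = h x + h (if x = c1 then c2 else c1)" for h :: "_ \<Rightarrow> real"
      using x c by auto
    have "T x = (\<Sum>as\<in>tuples U r. (\<Sum>cs\<in>tuples ?K r. of_bool (good (cs @ ds) (map col as @ ys)))
        + (\<Sum>cs\<in>tuples ?K r. of_bool (\<forall>a\<in>set as. col a = x) * of_bool (\<forall>y\<in>set ys. y = x)))"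
      unfolding T_def split
    proof (intro sum.cong arg_cong2[of _ _ _ _ "(+)"] refl)
      fix as cs assume "as \<in> tuples U r" "cs \<in> tuples ?K r"
      then show "of_bool (good ((if x = c1 then c2 else c1) # cs @ ds) (x # map col as @ ys)) =
          (of_bool (\<forall>a\<in>set as. col a = x) * of_bool (\<forall>y\<in>set ys. y = x) :: real)"
        using x c len by (auto simp: tuples_def)
    qed auto
    also have "\<dots> = good_count ?K U col ds ys r + 2 ^ r * of_bool (\<forall>y\<in>set ys. y = x) *
        (\<Sum>as\<in>tuples U r. of_bool (\<forall>a\<in>set as. col a = x))"
      using c by (simp add: sum.distrib good_count_def card_tuples sum_distrib_left mult_ac)
    finally show ?thesis by (simp only: sum_tuples_all[OF U] d_def)
  qed
  have "T x \<ge> 0" for x unfolding T_def by (intro sum_nonneg) auto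
  then have "(\<Sum>a\<in>U. T (col a)) \<ge> (\<Sum>a\<in>{a \<in> U. col a = c1} \<union> {a \<in> U. col a = c2}. T (col a))"
    using U by (intro sum_mono2) auto
  also have "(\<Sum>a\<in>{a \<in> U. col a = c1} \<union> {a \<in> U. col a = c2}. T (col a)) =
      (\<Sum>a\<in>{a \<in> U. col a = c1}. T c1) + (\<Sum>a\<in>{a \<in> U. col a = c2}. T c2)"
    using U c by (subst sum.union_disjoint) auto
  also have "(\<Sum>a\<in>U. T (col a)) = good_count ?K U col ds ys (Suc r)"
    unfolding good_count_def T_def sum_tuples_Suc by simp
  finally show ?thesis
    by (simp add: T d_def algebra_simps)
qed

section \<open>Lower bounds for the count at a single vertex\<close>

lemma power_ge_linear:
  fixes x :: real
  assumes "x \<ge> 0"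
  shows "x ^ n \<ge> 1 + real n * (x - 1)"
  using Bernoulli_inequality[of "x - 1" n] assms by simp

context
  fixes U :: "'a set" and col :: "'a \<Rightarrow> 'c" and c1 c2 :: 'c and k :: nat
  assumes finU: "finite U" and U_ne: "U \<noteq> {}" and c_ne: "c1 \<noteq> c2"
    and other: "card {a \<in> U. col a \<notin> {c1, c2}} \<le> k"
begin

private abbreviation (input) "N \<equiv> real (card U)"
private abbreviation (input) "p c \<equiv> real (card {a \<in> U. col a = c}) / N"
text \<open>Normalized by \<open>N ^ r\<close> but not by \<open>2 ^ r\<close>, so that the value to
  reach is the number \<open>r + 1\<close> of good patterns.\<close>

private abbreviation (input) "w ds ys r \<equiv> good_count {c1, c2} U col ds ys r / N ^ r"

lemma N_pos: "N > 0"
  using finU U_ne by (simp add: card_gt_0_iff)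

lemma p_sum: "p c1 + p c2 \<le> 1" "p c1 + p c2 \<ge> 1 - k / N"
proof -
  have U: "U = ({a \<in> U. col a = c1} \<union> {a \<in> U. col a = c2}) \<union> {a \<in> U. col a \<notin> {c1, c2}}" by auto
  have "card U = card {a \<in> U. col a = c1} + card {a \<in> U. col a = c2} + card {a \<in> U. col a \<notin> {c1, c2}}"
    using finU c_ne by (subst U, subst card_Un_disjoint, simp, simp, blast, subst card_Un_disjoint) auto
  then have "N = real (card {a \<in> U. col a = c1}) + real (card {a \<in> U. col a = c2})
      + real (card {a \<in> U. col a \<notin> {c1, c2}})"
    by linarith
  moreover have "real (card {a \<in> U. col a \<notin> {c1, c2}}) \<le> k" using other by simp
  ultimately have "real (card {a \<in> U. col a = c1}) + real (card {a \<in> U. col a = c2}) \<le> N"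
    "real (card {a \<in> U. col a = c1}) + real (card {a \<in> U. col a = c2}) \<ge> N - k" by linarith+
  then have "(real (card {a \<in> U. col a = c1}) + real (card {a \<in> U. col a = c2})) / N \<le> N / N"
    "(real (card {a \<in> U. col a = c1}) + real (card {a \<in> U. col a = c2})) / N \<ge> (N - k) / N"
    using N_pos by (intro divide_right_mono; simp)+
  then show "p c1 + p c2 \<le> 1" "p c1 + p c2 \<ge> 1 - k / N"
    using N_pos by (simp_all add: add_divide_distrib diff_divide_distrib)
qed

text \<open>The factor \<open>p c1 + p c2\<close> is at least \<open>1 - k / N\<close> and meets a
  count of at most \<open>2 ^ r\<close>. Writing \<open>2 ^ r * p ^ Suc r\<close> as
  \<open>(2 * p) ^ Suc r / 2\<close> places the tangent point of Bernoulli's inequality at the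
  balanced value \<open>p = 1 / 2\<close>.\<close>

lemma normalized_step:
  assumes len: "length ds = length ys"
  shows "w ds ys (Suc r) \<ge> w ds ys r - 2 ^ r * (k / N) +
    (of_bool (\<forall>y\<in>set ys. y = c1) * (2 * p c1) ^ Suc r +
     of_bool (\<forall>y\<in>set ys. y = c2) * (2 * p c2) ^ Suc r) / 2"
proof -
  let ?W = "good_count {c1, c2} U col ds ys"
  have le: "w ds ys r \<le> 2 ^ r"
    using good_count_le[OF finU, of "{c1, c2}" col ds ys r] c_ne N_pos
    by (simp add: power_mult_distrib divide_le_eq)
  have ge: "w ds ys r \<ge> 0"
    unfolding good_count_def by (intro divide_nonneg_nonneg sum_nonneg) auto
  have "w ds ys (Suc r) \<ge> (p c1 + p c2) * w ds ys r +
    (of_bool (\<forall>y\<in>set ys. y = c1) * (2 * p c1) ^ Suc r +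
     of_bool (\<forall>y\<in>set ys. y = c2) * (2 * p c2) ^ Suc r) / 2"
  proof -
    have "w ds ys (Suc r) \<ge> ((N * p c1 + N * p c2) * ?W r
     + 2 ^ r * (of_bool (\<forall>y\<in>set ys. y = c1) * (N * p c1) ^ Suc r +
        of_bool (\<forall>y\<in>set ys. y = c2) * (N * p c2) ^ Suc r)) / N ^ Suc r"
      using good_count_Suc[OF finU c_ne len, of col r] N_pos
      by (intro divide_right_mono) auto
    also have "((N * p c1 + N * p c2) * ?W r
     + 2 ^ r * (of_bool (\<forall>y\<in>set ys. y = c1) * (N * p c1) ^ Suc r +
        of_bool (\<forall>y\<in>set ys. y = c2) * (N * p c2) ^ Suc r)) / N ^ Suc r =
      (p c1 + p c2) * w ds ys r +
    (of_bool (\<forall>y\<in>set ys. y = c1) * (2 * p c1) ^ Suc r +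
     of_bool (\<forall>y\<in>set ys. y = c2) * (2 * p c2) ^ Suc r) / 2"
      using N_pos unfolding power_mult_distrib by (simp add: field_simps)
    finally show ?thesis .
  qed
  moreover have "(p c1 + p c2) * w ds ys r \<ge> (1 - k / N) * w ds ys r"
    using p_sum(2) ge by (rule mult_right_mono)
  moreover have "(k / N) * w ds ys r \<le> (k / N) * 2 ^ r"
    using le N_pos by (intro mult_left_mono) auto
  moreover have "(1 - k / N) * w ds ys r = w ds ys r - (k / N) * w ds ys r"
    by (simp only: left_diff_distrib mult_1_left)
  moreover have "(k / N) * 2 ^ r = 2 ^ r * (k / N)" by (rule mult.commute)
  ultimately show ?thesis by linarith
qed

text \<open>The linear terms from Bernoulli's inequality cancel up to a multiple of
  \<open>k / N\<close>, because \<open>p c1 + p c2\<close> is nearly 1. So each entry gains 1,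
  however the colors are split.\<close>

lemma normalized_free_step: "w [] [] (Suc r) \<ge> w [] [] r + 1 - 2 ^ Suc r * (k / N)"
proof -
  define \<kappa> where "\<kappa> = k / N"
  define q1 where "q1 = (2 * p c1) ^ Suc r"
  define q2 where "q2 = (2 * p c2) ^ Suc r"
  define R where "R = real (Suc r)"
  have "q1 \<ge> 1 + R * (2 * p c1 - 1)" "q2 \<ge> 1 + R * (2 * p c2 - 1)"
    unfolding q1_def q2_def R_def by (intro power_ge_linear; simp)+
  moreover have "R * (p c1 + p c2 - 1) \<ge> R * (- \<kappa>)"
    unfolding R_def \<kappa>_def using p_sum(2) by (intro mult_left_mono) auto
  moreover have "R * (p c1 + p c2 - 1) * 2 = R * (2 * p c1 - 1) + R * (2 * p c2 - 1)"
    by (simp only: algebra_simps)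
  moreover have "R * \<kappa> \<le> 2 ^ r * \<kappa>"
  proof (intro mult_right_mono)
    have "Suc r \<le> 2 ^ r" by (induction r) auto
    then show "R \<le> 2 ^ r" unfolding R_def by (metis of_nat_le_iff of_nat_numeral of_nat_power)
  qed (simp add: \<kappa>_def)
  ultimately have "(q1 + q2) / 2 \<ge> 1 - 2 ^ r * \<kappa>"
    by simp
  moreover have "w [] [] (Suc r) \<ge> w [] [] r - 2 ^ r * \<kappa> + (q1 + q2) / 2"
    using normalized_step[of "[]" "[]" r] unfolding q1_def q2_def \<kappa>_def by simp
  moreover have "(2 :: real) ^ Suc r * \<kappa> = 2 ^ r * \<kappa> + 2 ^ r * \<kappa>" by simp
  ultimately show ?thesis unfolding \<kappa>_def[symmetric] by linarith
qed

lemma normalized_free_mono: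
  "w [] [] (r + j) \<ge> w [] [] r + real j - (2 ^ Suc (r + j) - 2 ^ Suc r) * (k / N)"
proof -
  define \<kappa> where "\<kappa> = k / N"
  define f where "f = (\<lambda>r. w [] [] r)"
  have step: "f (Suc r) \<ge> f r + 1 - 2 ^ Suc r * \<kappa>" for r
    unfolding f_def \<kappa>_def by (rule normalized_free_step)
  have "f (r + j) \<ge> f r + real j - (2 ^ Suc (r + j) - 2 ^ Suc r) * \<kappa>"
  proof (induction j)
    case (Suc j)
    then show ?case
      using step[of "r + j"] by (simp add: algebra_simps)
  qed simp
  then show ?thesis unfolding f_def \<kappa>_def .
qed

lemma good_count_free:
  "good_count {c1, c2} U col [] [] r \<ge> (real r + 1 - 2 ^ Suc r * (k / N)) * N ^ r"
proof -
  define \<kappa> where "\<kappa> = k / N"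
  have "\<kappa> \<ge> 0" by (simp add: \<kappa>_def)
  moreover have "w [] [] 0 = 1" by (simp add: good_count_def)
  moreover have "w [] [] r \<ge> w [] [] 0 + real r - (2 ^ Suc r - 2 ^ Suc 0) * \<kappa>"
    using normalized_free_mono[of 0 r] by (simp only: \<kappa>_def add_0)
  moreover have "(2 ^ Suc r - 2 ^ Suc 0) * \<kappa> = 2 ^ Suc r * \<kappa> - 2 * \<kappa>"
    by (simp add: left_diff_distrib)
  ultimately have "w [] [] r \<ge> real r + 1 - 2 ^ Suc r * \<kappa>" by linarith
  then show ?thesis using N_pos unfolding \<kappa>_def by (simp only: pos_le_divide_eq zero_less_power)
qed

text \<open>In the second step the squares are kept: with bias \<omega>, half of
  \<open>(1 + \<omega>)^2 + (1 - \<omega>)^2\<close> is \<open>1 + \<omega>^2\<close>. All later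
  steps still gain 1.\<close>

lemma good_count_free_strong:
  assumes "r \<ge> 2"
  shows "good_count {c1, c2} U col [] [] r \<ge> (real r + 1 + (2 * p c1 - 1)\<^sup>2 - 2 ^ (r + 2) * (k / N)) * N ^ r"
proof -
  define \<kappa> where "\<kappa> = k / N"
  define \<omega> where "\<omega> = 2 * p c1 - 1"
  have \<kappa>: "\<kappa> \<ge> 0" by (simp add: \<kappa>_def)
  have p1: "p c1 \<ge> 0" "p c1 \<le> 1" "p c2 \<ge> 0" using p_sum(1) N_pos by (auto simp: field_simps intro: order_trans)
  have "w [] [] 0 = 1" by (simp add: good_count_def)
  then have w1: "w [] [] 1 \<ge> 2 - 2 * \<kappa>"
    using normalized_free_step[of 0] by (simp add: \<kappa>_def)
  \<comment> \<open>The bound \<open>1 - \<omega> - 2 * \<kappa>\<close> on \<open>2 * p c2\<close>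
    can be squared only if it is nonnegative; otherwise the right-hand side is at most 0.\<close>
  have "(2 * p c2)\<^sup>2 \<ge> (1 - \<omega>)\<^sup>2 - 8 * \<kappa>"
  proof (cases "1 - \<omega> - 2 * \<kappa> \<ge> 0")
    case True
    have "2 * p c2 \<ge> 1 - \<omega> - 2 * \<kappa>" using p_sum(2) unfolding \<omega>_def \<kappa>_def by linarith
    then have "(2 * p c2)\<^sup>2 \<ge> (1 - \<omega> - 2 * \<kappa>)\<^sup>2" using True by (intro power_mono) auto
    moreover have "(1 - \<omega> - 2 * \<kappa>)\<^sup>2 = (1 - \<omega>)\<^sup>2 - 4 * (\<kappa> * (1 - \<omega>)) + 4 * \<kappa>\<^sup>2"
      by (simp add: power2_eq_square algebra_simps)
    moreover have "\<kappa> * (1 - \<omega>) \<le> \<kappa> * 2" using \<kappa> p1 by (intro mult_left_mono) (auto simp: \<omega>_def)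
    moreover have "\<kappa>\<^sup>2 \<ge> 0" by simp
    ultimately show ?thesis by linarith
  next
    case False
    have "0 \<le> 1 - \<omega>" "1 - \<omega> \<le> 2" using p1 by (auto simp: \<omega>_def)
    then have "(1 - \<omega>) * (1 - \<omega>) \<le> 2 * (2 * \<kappa>)" using False by (intro mult_mono) auto
    then have "(1 - \<omega>)\<^sup>2 - 8 * \<kappa> \<le> 0" using \<kappa> by (simp add: power2_eq_square)
    then show ?thesis using zero_le_power2[of "2 * p c2"] by linarith
  qed
  moreover have "(2 * p c1)\<^sup>2 = (1 + \<omega>)\<^sup>2" by (simp add: \<omega>_def)
  moreover have "(1 + \<omega>)\<^sup>2 + (1 - \<omega>)\<^sup>2 = 2 + 2 * \<omega>\<^sup>2" by (simp add: power2_eq_square algebra_simps)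
  moreover have "(A + B) / 2 \<ge> 1 + C - 4 * K"
    if "B \<ge> E - 8 * K" "A = D" "D + E = 2 + 2 * C" for A B C D E K :: real
    using that by (simp add: field_simps)
  ultimately have sq: "((2 * p c1)\<^sup>2 + (2 * p c2)\<^sup>2) / 2 \<ge> 1 + \<omega>\<^sup>2 - 4 * \<kappa>" by blast
  have st: "w [] [] (Suc 1) \<ge> w [] [] 1 - 2 ^ 1 * \<kappa> + ((2 * p c1) ^ Suc 1 + (2 * p c2) ^ Suc 1) / 2"
    using normalized_step[of "[]" "[]" 1] unfolding \<kappa>_def by simp
  have w2: "w [] [] 2 \<ge> 3 + \<omega>\<^sup>2 - 8 * \<kappa>"
  proof -
    have "x2 \<ge> 3 + C - 8 * K"
      if "x2 \<ge> x1 - 2 ^ 1 * K + D / 2" "D / 2 \<ge> 1 + C - 4 * K" "x1 \<ge> 2 - 2 * K" "K \<ge> 0"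
      for x1 x2 C D K :: real
      using that by (simp add: field_simps)
    then show ?thesis
      using st sq w1 \<kappa> unfolding Suc_1 by blast
  qed
  obtain j where j: "r = 2 + j" using assms le_Suc_ex by blast
  have "w [] [] r \<ge> w [] [] 2 + real j - (2 ^ Suc r - 8) * \<kappa>"
    using normalized_free_mono[of 2 j] unfolding j \<kappa>_def by simp
  moreover have "0 \<le> 2 ^ Suc r * \<kappa>" using \<kappa> by simp
  moreover have "(2 ^ Suc r - 8) * \<kappa> = 2 ^ Suc r * \<kappa> - 8 * \<kappa>" "2 ^ (r + 2) * \<kappa> = 2 * (2 ^ Suc r * \<kappa>)"
    by (simp_all add: algebra_simps)
  moreover have "real r = 2 + real j" using j by simp
  ultimately have "w [] [] r \<ge> real r + 1 + \<omega>\<^sup>2 - 2 ^ (r + 2) * \<kappa>"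
    using w2 by linarith
  then show ?thesis using N_pos unfolding \<kappa>_def \<omega>_def by (simp only: pos_le_divide_eq zero_less_power)
qed

text \<open>Equal twins are good for every \<open>ds\<close>, so the count starts at 1. After a
  mismatch only a constant run in \<open>c1\<close> fits them, which adds half of
  \<open>1 + Suc r * \<omega>\<close>. At balance this gives \<open>1 + r / 2\<close>, against
  \<open>(r + 3) / 4\<close> for \<open>r + 2\<close> free entries on the same scale.\<close>

lemma good_count_twins:
  assumes "length ds = 2"
  shows "good_count {c1, c2} U col ds [c1, c1] r \<ge>
     (1 + real r / 2 + (2 * p c1 - 1) * real r * (real r + 1) / 4 - 2 ^ r * (k / N)) * N ^ r"
proof -
  define \<kappa> where "\<kappa> = k / N"
  define \<omega> where "\<omega> = 2 * p c1 - 1"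
  have "\<kappa> \<ge> 0" by (simp add: \<kappa>_def)
  let ?w = "w ds [c1, c1]"
  have "?w r \<ge> 1 + real r / 2 + \<omega> * real r * (real r + 1) / 4 - 2 ^ r * \<kappa>"
  proof (induction r)
    case 0
    have "good ds [c1, c1]" using assms by (intro good_const[where z = c1]) auto
    then show ?case using \<open>\<kappa> \<ge> 0\<close> by (simp add: good_count_def)
  next
    case (Suc r)
    have "(2 * p c1) ^ Suc r \<ge> 1 + real (Suc r) * \<omega>"
      unfolding \<omega>_def by (intro power_ge_linear) auto
    moreover have "?w (Suc r) \<ge> ?w r - 2 ^ r * \<kappa> + (2 * p c1) ^ Suc r / 2"
      using normalized_step[of ds "[c1, c1]" r] assms c_ne by (simp add: \<kappa>_def)
    ultimately show ?case using Suc by (simp add: field_simps)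
  qed
  then show ?thesis using N_pos unfolding \<kappa>_def \<omega>_def by (simp only: pos_le_divide_eq zero_less_power)
qed

end

text \<open>A new first entry collides with at most \<open>r + length us\<close> values. The factor
  \<open>card U\<close> on the left is the trivial bound on the good vertices that a tuple with
  repetitions contributes.\<close>

lemma card_not_distinct:
  assumes "finite U" "distinct us"
  shows "card U * card {as \<in> tuples U r. \<not> distinct (as @ us)} \<le> r * (r + length us) * card U ^ r"
proof (induction r)
  case 0
  then show ?case using assms by auto
next
  case (Suc r)
  let ?B = "\<lambda>r. {as \<in> tuples U r. \<not> distinct (as @ us)}"
  let ?N = "card U"
  have "?B (Suc r) \<subseteq> (\<lambda>(a, as). a # as) ` (U \<times> ?B r)
      \<union> (\<lambda>(as, a). a # as) ` (SIGMA as:tuples U r. set (as @ us))"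
  proof
    fix xs assume B: "xs \<in> ?B (Suc r)"
    then have "xs \<in> tuples U (Suc r)" by simp
    then obtain a as where xs: "xs = a # as" "a \<in> U" "as \<in> tuples U r"
      unfolding tuples_Suc by auto
    have nd: "\<not> distinct ((a # as) @ us)" using B xs(1) by blast
    show "xs \<in> (\<lambda>(a, as). a # as) ` (U \<times> ?B r)
      \<union> (\<lambda>(as, a). a # as) ` (SIGMA as:tuples U r. set (as @ us))"
    proof (cases "distinct (as @ us)")
      case True
      then have "(as, a) \<in> (SIGMA as:tuples U r. set (as @ us))" using xs nd by auto
      then show ?thesis using xs(1) by force
    next
      case False
      then have "(a, as) \<in> U \<times> ?B r" using xs by simp
      then show ?thesis using xs(1) by force
    qed
  qed
  then have "card (?B (Suc r)) \<le> card ((\<lambda>(a, as). a # as) ` (U \<times> ?B r)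
      \<union> (\<lambda>(as, a). a # as) ` (SIGMA as:tuples U r. set (as @ us)))"
    using assms by (intro card_mono) auto
  also have "\<dots> \<le> card (U \<times> ?B r) + card (SIGMA as:tuples U r. set (as @ us))"
    using assms by (intro order_trans[OF card_Un_le] add_mono card_image_le) auto
  also have "card (SIGMA as:tuples U r. set (as @ us)) = (\<Sum>as\<in>tuples U r. card (set (as @ us)))"
    using assms by (subst card_SigmaI) auto
  also have "\<dots> \<le> (\<Sum>as\<in>tuples U r. r + length us)"
    by (intro sum_mono order_trans[OF card_length]) (auto simp: tuples_def)
  also have "\<dots> = ?N ^ r * (r + length us)" using assms by (simp add: card_tuples)
  finally have "card (?B (Suc r)) \<le> ?N * card (?B r) + ?N ^ r * (r + length us)"
    by (simp add: card_cartesian_product)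
  then have "?N * card (?B (Suc r)) \<le> ?N * (?N * card (?B r)) + ?N * (?N ^ r * (r + length us))"
    unfolding add_mult_distrib2[symmetric] by (rule mult_le_mono2)
  also have "\<dots> \<le> ?N * (r * (r + length us) * ?N ^ r) + ?N * (?N ^ r * (r + length us))"
    using Suc by (intro add_mono mult_le_mono2) auto
  also have "\<dots> = Suc r * (r + length us) * ?N ^ Suc r" by (simp add: algebra_simps)
  also have "\<dots> \<le> Suc r * (Suc r + length us) * ?N ^ Suc r" by (intro mult_le_mono) auto
  finally show ?case .
qed

text \<open>Tuples with repetitions, and the vertices of the tuple itself, contribute only to the additive
  error term.\<close>

lemma sum_good_count_le:
  fixes \<chi> :: "'a set \<Rightarrow> 'c" and T :: real
  assumes U: "finite U" and B: "B \<subseteq> U" and us: "distinct us" and K: "finite K" and T: "T \<ge> 0"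
    and bound: "\<And>as cs. as \<in> tuples U r \<Longrightarrow> cs \<in> tuples K r \<Longrightarrow> distinct (as @ us) \<Longrightarrow>
      real (card (good_for \<chi> B (as @ us) (cs @ ds))) \<le> T"
  shows "(\<Sum>b\<in>B. good_count K U (\<lambda>a. \<chi> {b, a}) ds (pattern \<chi> us b) r) \<le>
    (real (card K) * real (card U)) ^ r * (T + real ((r + 1) * (r + length us)))"
proof -
  have finB: "finite B" using U B finite_subset by blast
  let ?N = "card U"
  let ?R = "\<lambda>as cs. {b \<in> B. good (cs @ ds) (pattern \<chi> (as @ us) b)}"
  have "(\<Sum>b\<in>B. good_count K U (\<lambda>a. \<chi> {b, a}) ds (pattern \<chi> us b) r) =
      (\<Sum>as\<in>tuples U r. \<Sum>b\<in>B. \<Sum>cs\<in>tuples K r. of_bool (good (cs @ ds) (pattern \<chi> (as @ us) b)))"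
    unfolding good_count_def pattern_def by (subst sum.swap) simp
  also have "\<dots> = (\<Sum>as\<in>tuples U r. \<Sum>cs\<in>tuples K r. \<Sum>b\<in>B. of_bool (good (cs @ ds) (pattern \<chi> (as @ us) b)))"
    by (intro sum.cong refl sum.swap)
  also have "\<dots> = (\<Sum>as\<in>tuples U r. \<Sum>cs\<in>tuples K r. real (card (?R as cs)))"
    using finB by (intro sum.cong refl) (simp add: Int_def)
  also have "\<dots> \<le> (\<Sum>as\<in>tuples U r. \<Sum>cs\<in>tuples K r.
      T + real (r + length us) + of_bool (\<not> distinct (as @ us)) * real ?N)"
  proof (intro sum_mono)
    fix as cs assume as: "as \<in> tuples U r" and cs: "cs \<in> tuples K r"
    show "real (card (?R as cs)) \<le> T + real (r + length us) + of_bool (\<not> distinct (as @ us)) * real ?N"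
    proof (cases "distinct (as @ us)")
      case True
      have "?R as cs \<subseteq> good_for \<chi> B (as @ us) (cs @ ds) \<union> set (as @ us)"
        by (auto simp: good_for_def)
      then have "card (?R as cs) \<le> card (good_for \<chi> B (as @ us) (cs @ ds) \<union> set (as @ us))"
        using finB by (intro card_mono) (auto simp: finite_good_for)
      also have "\<dots> \<le> card (good_for \<chi> B (as @ us) (cs @ ds)) + length (as @ us)"
        by (intro order_trans[OF card_Un_le] add_left_mono card_length)
      finally have "real (card (?R as cs)) \<le> real (card (good_for \<chi> B (as @ us) (cs @ ds))) + real (r + length us)"
        using as by (simp add: tuples_def)
      then show ?thesis using bound[OF as cs True] True by simp
    next
      case False
      have "card (?R as cs) \<le> ?N" using U B by (intro card_mono) auto
      then show ?thesis using False T by simp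
    qed
  qed
  also have "\<dots> = real (card K) ^ r * (real ?N ^ r * (T + real (r + length us))
      + real (?N * card {as \<in> tuples U r. \<not> distinct (as @ us)}))"
    using U K by (simp add: sum.distrib card_tuples Int_def flip: sum_distrib_left sum_distrib_right)
  also have "\<dots> \<le> real (card K) ^ r * (real ?N ^ r * (T + real (r + length us))
      + real (r * (r + length us) * ?N ^ r))"
    by (intro mult_left_mono add_left_mono of_nat_mono card_not_distinct[OF U us]) auto
  also have "\<dots> = (real (card K) * real ?N) ^ r * (T + real ((r + 1) * (r + length us)))"
    by (simp add: power_mult_distrib algebra_simps)
  finally show ?thesis .
qed

text \<open>The extra 1 is \<open>b\<close> itself: tuples may contain \<open>b\<close>, and
  \<open>{b, b}\<close> is a singleton of arbitrary color.\<close>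

lemma card_other_le:
  assumes "finite U" "other_degree \<chi> (- K) U b \<le> k"
  shows "card {a \<in> U. \<chi> {b, a} \<notin> K} \<le> k + 1"
proof -
  have "card {a \<in> U. \<chi> {b, a} \<notin> K} \<le> card (insert b {a \<in> U. a \<noteq> b \<and> \<chi> {b, a} \<in> - K})"
    using assms by (intro card_mono) auto
  also have "\<dots> \<le> Suc (other_degree \<chi> (- K) U b)"
    unfolding other_degree_def by (rule card_insert_le_m1) auto
  finally show ?thesis using assms by simp
qed

text \<open>Some distinct tuple reaches the average given by \<open>good_count_free\<close>, up to
  an additive error depending only on \<open>s\<close> and \<open>k\<close>.\<close>

lemma exists_many_good:
  fixes \<chi> :: "'a set \<Rightarrow> 'c"
  assumes U: "finite U" and s: "s \<le> card U" and ne: "U \<noteq> {}" and c: "c1 \<noteq> c2"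
    and deg: "\<And>b. b \<in> U \<Longrightarrow> other_degree \<chi> (- {c1, c2}) U b \<le> k"
  shows "\<exists>as cs. distinct as \<and> as \<in> tuples U s \<and> length cs = s \<and>
    (real s + 1) * card U \<le> 2 ^ s * (card (good_for \<chi> U as cs) + real ((s + 1) * s) + 2 * real (k + 1) + 1)"
proof (rule ccontr)
  assume neg: "\<not> ?thesis"
  \<comment> \<open>The average minus the error terms and a final 1, which becomes the surplus
    \<open>2 ^ s\<close> of the contradiction.\<close>
  define T where "T = (real s + 1) * card U / 2 ^ s - real ((s + 1) * s) - 2 * real (k + 1) - 1"
  have less: "real (card (good_for \<chi> U as cs)) < T"
    if "distinct as" "as \<in> tuples U s" "length cs = s" for as cs
  proof -
    have "2 ^ s * (card (good_for \<chi> U as cs) + real ((s + 1) * s) + 2 * real (k + 1) + 1) < (real s + 1) * card U"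
      by (rule ccontr) (use neg that in \<open>simp only: not_less, blast\<close>)
    then have "card (good_for \<chi> U as cs) + real ((s + 1) * s) + 2 * real (k + 1) + 1 < (real s + 1) * card U / 2 ^ s"
      by (simp only: pos_less_divide_eq zero_less_power zero_less_numeral mult.commute)
    then show ?thesis by (simp add: T_def)
  qed
  \<comment> \<open>A concrete distinct tuple shows \<open>T > 0\<close>, which
    \<open>sum_good_count_le\<close> requires in the weak form.\<close>
  obtain A where A: "A \<subseteq> U" "card A = s" "finite A" using obtain_subset_with_card_n[OF s] by blast
  obtain as where as: "set as = A" "distinct as" using finite_distinct_list[OF A(3)] by blast
  then have "as \<in> tuples U s" using A by (auto simp: tuples_def distinct_card[symmetric])
  then have "T > 0"
    using less[OF as(2), of "replicate s c1"] by (smt (verit) length_replicate of_nat_0_le_iff)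
  have N: "real (card U) > 0" using U ne by (simp add: card_gt_0_iff)
  have "(real s + 1 - 2 ^ Suc s * (real (k + 1) / card U)) * real (card U) ^ s * card U \<le>
      (\<Sum>b\<in>U. good_count {c1, c2} U (\<lambda>a. \<chi> {b, a}) [] (pattern \<chi> [] b) s)"
  proof -
    have "(\<Sum>b\<in>U. (real s + 1 - 2 ^ Suc s * (real (k + 1) / card U)) * real (card U) ^ s) \<le>
      (\<Sum>b\<in>U. good_count {c1, c2} U (\<lambda>a. \<chi> {b, a}) [] [] s)"
      using good_count_free[OF U ne c card_other_le[OF U deg]] by (intro sum_mono) blast
    then show ?thesis by (simp add: mult_ac)
  qed
  also have "\<dots> \<le> (real (card {c1, c2}) * real (card U)) ^ s * (T + real ((s + 1) * (s + length ([] :: 'a list))))"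
    using less \<open>T > 0\<close> U by (intro sum_good_count_le) (auto simp: tuples_def intro: less_imp_le)
  also have "\<dots> = real (card U) ^ s * (2 ^ s * (T + real ((s + 1) * s)))"
    using c by (simp add: power_mult_distrib)
  finally have "real (card U) ^ s * ((real s + 1 - 2 ^ Suc s * (real (k + 1) / card U)) * card U) \<le>
    real (card U) ^ s * (2 ^ s * (T + real ((s + 1) * s)))" by (simp only: mult_ac)
  then have "(real s + 1 - 2 ^ Suc s * (real (k + 1) / card U)) * card U \<le> 2 ^ s * (T + real ((s + 1) * s))"
    using N by (simp only: mult_le_cancel_left_pos zero_less_power)
  moreover have "(real s + 1 - 2 ^ Suc s * (real (k + 1) / card U)) * card U =
     (real s + 1) * card U - 2 ^ s * (2 * real (k + 1))"
    using N by (simp add: field_simps)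
  moreover have "2 ^ s * (T + real ((s + 1) * s)) = (real s + 1) * card U - 2 ^ s * (2 * real (k + 1)) - 2 ^ s"
    by (simp add: T_def field_simps)
  moreover have "(2 :: real) ^ s > 0" by simp
  ultimately show False by linarith
qed

subsection \<open>A random 2-coloring\<close>

lemma sum_Pow_Un:
  fixes f g :: "'a set \<Rightarrow> real"
  assumes "finite A" "finite B" "A \<inter> B = {}"
  shows "(\<Sum>S\<in>Pow (A \<union> B). f (S \<inter> A) * g (S \<inter> B)) = (\<Sum>S\<in>Pow A. f S) * (\<Sum>S\<in>Pow B. g S)"
proof -
  have "(\<Sum>S\<in>Pow (A \<union> B). f (S \<inter> A) * g (S \<inter> B)) = (\<Sum>(S, S')\<in>Pow A \<times> Pow B. f S * g S')"
    using assms
    by (intro sum.reindex_bij_witness[of _ "\<lambda>(S, S'). S \<union> S'" "\<lambda>S. (S \<inter> A, S \<inter> B)"]) auto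
  also have "\<dots> = (\<Sum>S\<in>Pow A. f S) * (\<Sum>S\<in>Pow B. g S)"
    by (simp add: sum_product sum.cartesian_product)
  finally show ?thesis .
qed

text \<open>Independence in counting form: a uniformly random subset behaves independently on the
  disjoint sets \<open>E i\<close>.\<close>

lemma sum_Pow_prod:
  fixes f :: "'i \<Rightarrow> 'a set \<Rightarrow> real"
  assumes "finite I" "finite R" "\<And>i. i \<in> I \<Longrightarrow> finite (E i)"
    and "\<And>i. i \<in> I \<Longrightarrow> R \<inter> E i = {}" "\<And>i j. i \<in> I \<Longrightarrow> j \<in> I \<Longrightarrow> i \<noteq> j \<Longrightarrow> E i \<inter> E j = {}"
  shows "(\<Sum>S\<in>Pow (R \<union> (\<Union>i\<in>I. E i)). \<Prod>i\<in>I. f i (S \<inter> E i)) =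
    2 ^ card R * (\<Prod>i\<in>I. \<Sum>S\<in>Pow (E i). f i S)"
  using assms
proof (induction I rule: finite_induct)
  case empty
  then show ?case by (simp add: card_Pow)
next
  case (insert i I)
  let ?B = "R \<union> (\<Union>i\<in>I. E i)"
  have disj: "E i \<inter> ?B = {}" using insert.prems insert.hyps by blast
  have fin: "finite (E i)" "finite ?B" using insert.prems insert.hyps by auto
  have "(\<Sum>S\<in>Pow (R \<union> (\<Union>i\<in>insert i I. E i)). \<Prod>i\<in>insert i I. f i (S \<inter> E i)) =
      (\<Sum>S\<in>Pow (E i \<union> ?B). f i (S \<inter> E i) * (\<Prod>j\<in>I. f j ((S \<inter> ?B) \<inter> E j)))"
  proof (rule sum.cong)
    show "Pow (R \<union> (\<Union>i\<in>insert i I. E i)) = Pow (E i \<union> ?B)" by (rule arg_cong[of _ _ Pow]) auto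
    fix S
    have "(\<Prod>j\<in>I. f j (S \<inter> E j)) = (\<Prod>j\<in>I. f j ((S \<inter> ?B) \<inter> E j))"
      by (intro prod.cong refl arg_cong[of _ _ "f _"]) auto
    then show "(\<Prod>i\<in>insert i I. f i (S \<inter> E i)) = f i (S \<inter> E i) * (\<Prod>j\<in>I. f j ((S \<inter> ?B) \<inter> E j))"
      using insert.hyps by simp
  qed
  also have "\<dots> = (\<Sum>S\<in>Pow (E i). f i S) * (\<Sum>S\<in>Pow ?B. \<Prod>j\<in>I. f j (S \<inter> E j))"
    by (rule sum_Pow_Un[OF fin disj])
  also have "(\<Sum>S\<in>Pow ?B. \<Prod>j\<in>I. f j (S \<inter> E j)) = 2 ^ card R * (\<Prod>i\<in>I. \<Sum>S\<in>Pow (E i). f i S)"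
    using insert.prems by (intro insert.IH) auto
  finally show ?case using insert.hyps by simp
qed

text \<open>A uniformly random coloring is a uniformly random set \<open>S\<close> of edges, so
  expectations become sums over \<open>Pow\<close>.\<close>

definition set_coloring :: "'a set set \<Rightarrow> 'a set \<Rightarrow> nat" where
  "set_coloring S e = of_bool (e \<in> S)"

lemma sum_Pow_eq_sum_tuples:
  fixes F :: "nat list \<Rightarrow> real"
  assumes "distinct es"
  shows "(\<Sum>S\<in>Pow (set es). F (map (set_coloring S) es)) = (\<Sum>xs\<in>tuples {0, 1} (length es). F xs)"
  using assms
proof (induction es arbitrary: F)
  case Nil
  then show ?case by simp
next
  case (Cons e es)
  have map: "map (set_coloring (insert e S)) es = map (set_coloring S) es"
    "set_coloring S e = 0" "set_coloring (insert e S) e = 1"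
    if "S \<in> Pow (set es)" for S
    using that Cons.prems by (auto simp: set_coloring_def)
  have disj: "Pow (set es) \<inter> insert e ` Pow (set es) = {}" using Cons.prems by auto
  have inj: "inj_on (insert e) (Pow (set es))"
  proof (rule inj_onI)
    fix S S' assume "S \<in> Pow (set es)" "S' \<in> Pow (set es)" "insert e S = insert e S'"
    then show "S = S'" using Cons.prems by (metis PowD distinct.simps(2) insert_ident subsetD)
  qed
  have "(\<Sum>S\<in>Pow (set (e # es)). F (map (set_coloring S) (e # es))) =
    (\<Sum>S\<in>Pow (set es). F (0 # map (set_coloring S) es)) + (\<Sum>S\<in>Pow (set es). F (1 # map (set_coloring S) es))"
  proof -
    have "(\<Sum>S\<in>insert e ` Pow (set es). F (map (set_coloring S) (e # es))) =
        (\<Sum>S\<in>Pow (set es). F (1 # map (set_coloring S) es))"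
      unfolding sum.reindex[OF inj] by (intro sum.cong refl) (simp add: map o_def)
    moreover have "(\<Sum>S\<in>Pow (set es). F (map (set_coloring S) (e # es))) =
        (\<Sum>S\<in>Pow (set es). F (0 # map (set_coloring S) es))"
      by (intro sum.cong refl) (simp add: map)
    ultimately show ?thesis using disj by (simp add: Pow_insert sum.union_disjoint)
  qed
  also have "\<dots> = (\<Sum>xs\<in>tuples {0, 1} (length es). F (0 # xs)) + (\<Sum>xs\<in>tuples {0, 1} (length es). F (1 # xs))"
    using Cons.IH[of "\<lambda>xs. F (0 # xs)"] Cons.IH[of "\<lambda>xs. F (1 # xs)"] Cons.prems by simp
  finally show ?case by (simp add: sum_tuples_Suc)
qed

text \<open>A good pattern is determined by the length of its matching prefix, from 0 to
  \<open>s\<close>: with two colors the first mismatch fixes the color of the whole tail.\<close>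

lemma sum_good_tuples:
  assumes "cs \<in> tuples {0, 1 :: nat} s"
  shows "(\<Sum>xs\<in>tuples {0, 1 :: nat} s. of_bool (good cs xs) :: real) = real s + 1"
  using assms
proof (induction s arbitrary: cs)
  case 0
  then show ?case by simp
next
  case (Suc s)
  then obtain c cs' where cs: "cs = c # cs'" "c \<in> {0, 1}" "cs' \<in> tuples {0, 1} s"
    by (auto simp: tuples_Suc)
  have len: "length cs' = s" using cs(3) by (simp add: tuples_def)
  have const: "(\<Sum>xs\<in>tuples {0, 1 :: nat} s. of_bool (length cs' = length xs \<and> (\<forall>y\<in>set xs. y = x)) :: real) = 1"
    if "x \<in> {0, 1}" for x
  proof -
    have "(\<Sum>xs\<in>tuples {0, 1 :: nat} s. of_bool (length cs' = length xs \<and> (\<forall>y\<in>set xs. y = x)) :: real)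
       = (\<Sum>xs\<in>tuples {0, 1 :: nat} s. of_bool (\<forall>y\<in>set xs. y = x))"
      by (intro sum.cong refl) (auto simp: tuples_def len)
    also have "\<dots> = real (card {a \<in> {0, 1 :: nat}. a = x}) ^ s"
      by (rule sum_tuples_all) simp
    also have "{a \<in> {0, 1 :: nat}. a = x} = {x}" using that by auto
    finally show ?thesis by simp
  qed
  show ?case
    using cs(2) const[of 0] const[of 1] Suc.IH[OF cs(3)]
    by (auto simp: sum_tuples_Suc cs(1))
qed

context
  fixes n s :: nat and as :: "nat list" and cs :: "nat list" and \<Lambda> :: real
  assumes as: "distinct as" "as \<in> tuples {..<n} s" and cs: "cs \<in> tuples {0, 1} s" and \<Lambda>: "\<Lambda> > 0"
begin

private abbreviation (input) "Edges \<equiv> {{x, y} | x y. x < n \<and> y < n}"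

text \<open>Different outside vertices reach the tuple through disjoint sets of edges, so the number
  of good vertices is binomial with success probability \<open>(s + 1) / 2 ^ s\<close>. This bounds
  its moment generating function by means of \<open>1 + x \<le> exp x\<close>.\<close>

lemma exponential_moment:
  "(\<Sum>S\<in>Pow Edges. exp (\<Lambda> * card (good_for (set_coloring S) {..<n} as cs))) \<le>
     2 ^ card Edges * exp (real n * ((real s + 1) / 2 ^ s) * (exp \<Lambda> - 1))"
proof -
  define B where "B = {..<n} - set as"
  define E where "E = (\<lambda>b. set (map (\<lambda>a. {b, a}) as))"
  define R where "R = Edges - (\<Union>b\<in>B. E b)"
  define p where "p = (real s + 1) / 2 ^ s"
  define f where "f = (\<lambda>b S. if good cs (pattern (set_coloring S) as b) then exp \<Lambda> else 1)"
  have "Edges \<subseteq> Pow {..<n}" by auto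
  then have fin: "finite Edges" by (rule finite_subset) simp
  have finB: "finite B" by (simp add: B_def)
  have len: "length as = s" "set as \<subseteq> {..<n}" using as by (auto simp: tuples_def)
  have E_sub: "E b \<subseteq> Edges" if "b \<in> B" for b
    using that len by (auto simp: E_def B_def)
  have Edges: "Edges = R \<union> (\<Union>b\<in>B. E b)" using E_sub by (auto simp: R_def)
  have disj: "E b \<inter> E b' = {}" if "b \<in> B" "b' \<in> B" "b \<noteq> b'" for b b'
    using that by (auto simp: E_def B_def doubleton_eq_iff)
  have dist: "distinct (map (\<lambda>a. {b, a}) as)" if "b \<in> B" for b
    using as(1) by (auto simp: distinct_map inj_on_def doubleton_eq_iff)
  have local: "f b (S \<inter> E b) = f b S" for b S
  proof -
    have "pattern (set_coloring (S \<inter> E b)) as b = pattern (set_coloring S) as b"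
      by (auto simp: pattern_def set_coloring_def E_def)
    then show ?thesis by (simp add: f_def)
  qed
  have "exp (\<Lambda> * card (good_for (set_coloring S) {..<n} as cs)) = (\<Prod>b\<in>B. f b (S \<inter> E b))" for S
  proof -
    have "(\<Prod>b\<in>B. f b S) = exp \<Lambda> ^ card {b \<in> B. good cs (pattern (set_coloring S) as b)}"
      unfolding f_def using finB by (subst prod.If_cases) (auto simp: Int_def)
    also have "{b \<in> B. good cs (pattern (set_coloring S) as b)} = good_for (set_coloring S) {..<n} as cs"
      by (auto simp: good_for_def B_def)
    finally show ?thesis by (simp add: local exp_of_nat_mult[symmetric] mult.commute)
  qed
  then have "(\<Sum>S\<in>Pow Edges. exp (\<Lambda> * card (good_for (set_coloring S) {..<n} as cs))) =
      (\<Sum>S\<in>Pow (R \<union> (\<Union>b\<in>B. E b)). \<Prod>b\<in>B. f b (S \<inter> E b))"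
    using Edges by simp
  also have "\<dots> = 2 ^ card R * (\<Prod>b\<in>B. \<Sum>S\<in>Pow (E b). f b S)"
    using fin finB disj by (intro sum_Pow_prod) (auto simp: R_def E_def)
  also have "(\<Prod>b\<in>B. \<Sum>S\<in>Pow (E b). f b S) = (\<Prod>b\<in>B. 2 ^ s * (1 + p * (exp \<Lambda> - 1)))"
  proof (intro prod.cong refl)
    fix b assume b: "b \<in> B"
    have "(\<Sum>S\<in>Pow (E b). f b S) =
        (\<Sum>S\<in>Pow (set (map (\<lambda>a. {b, a}) as)). (\<lambda>xs. if good cs xs then exp \<Lambda> else 1)
          (map (set_coloring S) (map (\<lambda>a. {b, a}) as)))"
      by (simp add: E_def f_def pattern_def o_def)
    also have "\<dots> = (\<Sum>xs\<in>tuples {0, 1} s. if good cs xs then exp \<Lambda> else 1)"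
      using sum_Pow_eq_sum_tuples[OF dist[OF b], of "\<lambda>xs. if good cs xs then exp \<Lambda> else 1"] len(1)
      by (simp only: length_map)
    also have "\<dots> = (\<Sum>xs\<in>tuples {0, 1 :: nat} s. 1 + (exp \<Lambda> - 1) * of_bool (good cs xs))"
      by (intro sum.cong) auto
    also have "\<dots> = 2 ^ s + (exp \<Lambda> - 1) * (real s + 1)"
      using sum_good_tuples[OF cs] by (simp add: sum.distrib card_tuples flip: sum_distrib_left)
    also have "real s + 1 = 2 ^ s * p" by (simp add: p_def)
    finally show "(\<Sum>S\<in>Pow (E b). f b S) = 2 ^ s * (1 + p * (exp \<Lambda> - 1))"
      by (simp only: algebra_simps)
  qed
  also have "\<dots> = (2 ^ s) ^ card B * (1 + p * (exp \<Lambda> - 1)) ^ card B"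
    by (simp add: power_mult_distrib)
  also have "2 ^ card R * \<dots> = 2 ^ card Edges * (1 + p * (exp \<Lambda> - 1)) ^ card B"
  proof -
    have "card Edges = card R + card (\<Union>b\<in>B. E b)"
      unfolding Edges using fin finB by (intro card_Un_disjoint) (auto simp: R_def E_def)
    also have "card (\<Union>b\<in>B. E b) = (\<Sum>b\<in>B. card (E b))"
      using finB disj by (intro card_UN_disjoint) (auto simp: E_def)
    also have "\<dots> = s * card B"
      using distinct_card[OF dist] len(1) by (simp add: E_def)
    finally show ?thesis by (simp add: power_add power_mult)
  qed
  also have "\<dots> \<le> 2 ^ card Edges * exp (real n * p * (exp \<Lambda> - 1))"
  proof (intro mult_left_mono)
    have "exp \<Lambda> - 1 \<ge> 0" "p \<ge> 0" using \<Lambda> by (auto simp: p_def)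
    then have nn: "p * (exp \<Lambda> - 1) \<ge> 0" by simp
    then have "(1 + p * (exp \<Lambda> - 1)) ^ card B \<le> exp (p * (exp \<Lambda> - 1)) ^ card B"
      by (intro power_mono exp_ge_add_one_self) auto
    also have "\<dots> = exp (card B * (p * (exp \<Lambda> - 1)))" by (simp add: exp_of_nat_mult)
    also have "\<dots> \<le> exp (real n * (p * (exp \<Lambda> - 1)))"
    proof -
      have "card B \<le> n" unfolding B_def using card_mono[of "{..<n}" "{..<n} - set as"] by simp
      then show ?thesis using nn by (simp add: mult_right_mono)
    qed
    finally show "(1 + p * (exp \<Lambda> - 1)) ^ card B \<le> exp (real n * p * (exp \<Lambda> - 1))"
      by (simp add: mult.assoc)
  qed simp
  finally show ?thesis by (simp add: p_def)
qed

end

text \<open>Chernoff's method with a union bound over \<open>Q\<close>: if the mean of the sum of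
  all \<open>exp (\<Lambda> * (X - t))\<close>, with \<open>X\<close> the number of good vertices,
  is below 1, some coloring makes every term smaller than 1 and hence every \<open>X\<close> smaller
  than \<open>t\<close>.\<close>

lemma exists_coloring_without_biclique:
  fixes \<Lambda> :: real
  assumes t: "t \<ge> 1" and \<Lambda>: "\<Lambda> > 0"
    and less: "real n ^ s * 2 ^ s * exp (real n * ((real s + 1) / 2 ^ s) * (exp \<Lambda> - 1) - \<Lambda> * t) < 1"
  shows "\<exists>\<chi> :: nat set \<Rightarrow> nat. range \<chi> \<subseteq> {0, 1} \<and> \<not> has_ordered_biclique {..<n} \<chi> s t"
proof -
  define Edges where "Edges = {{x, y} | x y. x < n \<and> y < n}"
  define M where "M = real n * ((real s + 1) / 2 ^ s) * (exp \<Lambda> - 1)"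
  define Q where "Q = {as \<in> tuples {..<n} s. distinct as} \<times> tuples {0, 1 :: nat} s"
  let ?X = "\<lambda>S as cs. real (card (good_for (set_coloring S) {..<n} as cs))"
  have finQ: "finite Q" by (simp add: Q_def)
  have "Edges \<subseteq> Pow {..<n}" by (auto simp: Edges_def)
  then have fin: "finite Edges" by (rule finite_subset) simp
  have cardQ: "real (card Q) \<le> real n ^ s * 2 ^ s"
  proof -
    have "card Q \<le> card (tuples {..<n} s \<times> tuples {0, 1 :: nat} s)"
      unfolding Q_def by (intro card_mono) auto
    also have "\<dots> = n ^ s * 2 ^ s" by (simp add: card_cartesian_product card_tuples numeral_2_eq_2)
    finally have "real (card Q) \<le> real (n ^ s * 2 ^ s)" by (rule of_nat_mono)
    then show ?thesis by simp
  qed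
  have "(\<Sum>S\<in>Pow Edges. \<Sum>(as, cs)\<in>Q. exp (\<Lambda> * (?X S as cs - t))) =
      (\<Sum>(as, cs)\<in>Q. exp (- \<Lambda> * t) * (\<Sum>S\<in>Pow Edges. exp (\<Lambda> * ?X S as cs)))"
    unfolding case_prod_beta
    by (subst sum.swap) (simp add: sum_distrib_left algebra_simps flip: exp_add)
  also have "\<dots> \<le> (\<Sum>(as, cs)\<in>Q. exp (- \<Lambda> * t) * (2 ^ card Edges * exp M))"
    unfolding case_prod_beta M_def Edges_def
    by (intro sum_mono mult_left_mono exponential_moment) (auto simp: Q_def \<Lambda>)
  also have "\<dots> = real (card Q) * exp (M - \<Lambda> * t) * 2 ^ card Edges"
    by (simp add: exp_diff exp_minus field_simps)
  also have "\<dots> \<le> (real n ^ s * 2 ^ s) * exp (M - \<Lambda> * t) * 2 ^ card Edges"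
    using cardQ by (intro mult_right_mono) auto
  also have "\<dots> < 2 ^ card Edges"
    using less unfolding M_def by simp
  also have "\<dots> = (\<Sum>S\<in>Pow Edges. 1)" using fin by (simp add: card_Pow)
  finally have "\<exists>S\<in>Pow Edges. (\<Sum>(as, cs)\<in>Q. exp (\<Lambda> * (?X S as cs - t))) < 1"
    by (meson sum_mono not_le)
  then obtain S where S: "(\<Sum>(as, cs)\<in>Q. exp (\<Lambda> * (?X S as cs - t))) < 1" by blast
  have X: "?X S as cs < t" if "(as, cs) \<in> Q" for as cs
  proof -
    have "exp (\<Lambda> * (?X S as cs - t)) \<le> (\<Sum>(as, cs)\<in>Q. exp (\<Lambda> * (?X S as cs - t)))"
      using member_le_sum[OF that, of "\<lambda>(as, cs). exp (\<Lambda> * (?X S as cs - t))"] finQ by auto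
    then have "exp (\<Lambda> * (?X S as cs - t)) < 1" using S by (rule le_less_trans)
    then have "\<Lambda> * (?X S as cs - t) < 0" by simp
    then show ?thesis using \<Lambda> by (simp add: mult_less_0_iff)
  qed
  have "\<not> has_ordered_biclique {..<n} (set_coloring S) s t"
  proof
    assume "has_ordered_biclique {..<n} (set_coloring S) s t"
    then obtain as cs where as: "distinct as" "set as \<subseteq> {..<n}" "length as = s"
      and card: "t \<le> card (good_for (set_coloring S) {..<n} as cs)"
      unfolding has_ordered_biclique_def by blast
    have "good_for (set_coloring S) {..<n} as cs \<noteq> {}" using card t by auto
    then have len: "length cs = s" using as(3) by (auto simp: good_for_def dest: good_length)
    \<comment> \<open>The forward colors of a copy are arbitrary numbers, whereas \<open>Q\<close>
      covers only the lists over \<open>{0, 1}\<close>.\<close>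
    define cs' where "cs' = map (\<lambda>c. if c \<in> {0, 1} then c else 0) cs"
    have "good_for (set_coloring S) {..<n} as cs \<subseteq> good_for (set_coloring S) {..<n} as cs'"
    proof
      fix b assume b: "b \<in> good_for (set_coloring S) {..<n} as cs"
      have "good cs' (pattern (set_coloring S) as b)"
        unfolding cs'_def
      proof (rule good_clamp)
        show "set (pattern (set_coloring S) as b) \<subseteq> {0, 1}" by (auto simp: set_coloring_def)
      qed (use b in \<open>auto simp: good_for_def\<close>)
      then show "b \<in> good_for (set_coloring S) {..<n} as cs'" using b by (simp add: good_for_def)
    qed
    then have "t \<le> card (good_for (set_coloring S) {..<n} as cs')"
      using card card_mono[OF finite_good_for] le_trans finite_lessThan by blast
    moreover have "(as, cs') \<in> Q" using as len by (auto simp: Q_def tuples_def cs'_def)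
    ultimately show False using X[of as cs'] by simp
  qed
  moreover have "range (set_coloring S) \<subseteq> {0, 1}" by (auto simp: set_coloring_def)
  ultimately show ?thesis by blast
qed

subsection \<open>The two Ramsey numbers\<close>

text \<open>Colors may be merged: where a mismatch turns into a match, the tail is constant and
  therefore still good.\<close>

lemma good_map: "good cs xs \<Longrightarrow> good (map g cs) (map g xs)"
proof (induction cs xs rule: good.induct)
  case (2 c cs x xs)
  then show ?case
    by (auto split: if_splits intro!: good_const)
qed auto

text \<open>Carries a copy from a coloring with colors 0 and 1 to one with two arbitrary, possibly
  equal, colors.\<close>

lemma has_ordered_biclique_recolor:
  assumes "has_ordered_biclique V \<chi> s t" "finite V"
    and "\<And>x y. x \<in> V \<Longrightarrow> y \<in> V \<Longrightarrow> x \<noteq> y \<Longrightarrow> \<chi>' {x, y} = g (\<chi> {x, y})"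
  shows "has_ordered_biclique V \<chi>' s t"
proof -
  obtain as cs where as: "distinct as" "set as \<subseteq> V" "length as = s" "t \<le> card (good_for \<chi> V as cs)"
    using assms(1) by (auto simp: has_ordered_biclique_def)
  have "good_for \<chi> V as cs \<subseteq> good_for \<chi>' V as (map g cs)"
  proof
    fix b assume b: "b \<in> good_for \<chi> V as cs"
    then have "pattern \<chi>' as b = map g (pattern \<chi> as b)"
      using as(2) assms(3)[of b] by (auto simp: pattern_def good_for_def)
    then show "b \<in> good_for \<chi>' V as (map g cs)"
      using b good_map by (auto simp: good_for_def)
  qed
  then have "t \<le> card (good_for \<chi>' V as (map g cs))"
    using as(4) card_mono[OF finite_good_for[OF assms(2)]] le_trans by blast
  then show ?thesis using as unfolding has_ordered_biclique_def by blast
qed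

lemma rainbow_triangle_copy_iff:
  "(\<exists>H. copy_in (complete_graph 3) (complete_graph n) H \<and> rainbow H \<chi>) \<longleftrightarrow>
    \<not> rainbow_triangle_free {..<n} \<chi>"
proof
  assume "\<exists>H. copy_in (complete_graph 3) (complete_graph n) H \<and> rainbow H \<chi>"
  then obtain H where H: "copy_in (complete_graph 3) (complete_graph n) H" "inj_on \<chi> (edges H)"
    by (auto simp: rainbow_def)
  then obtain f where f: "bij_betw f {..<3 :: nat} (verts H)" "verts H \<subseteq> {..<n}"
    and fe: "\<And>u v. u < 3 \<Longrightarrow> v < 3 \<Longrightarrow> {u, v} \<in> edges (complete_graph 3) \<longleftrightarrow> {f u, f v} \<in> edges H"
    unfolding copy_in_def graph_iso_def subgraph_of_def by (auto simp: complete_graph_def)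
  have E: "{f u, f v} \<in> edges H" if "u < 3" "v < 3" "u \<noteq> v" for u v
    using fe[OF that(1,2)] that by (simp add: complete_graph_def nsets_def)
  have inj: "f u \<noteq> f v" if "u < 3" "v < 3" "u \<noteq> v" for u v
    using f(1) that by (auto simp: bij_betw_def inj_on_def)
  have mem: "f u \<in> {..<n}" if "u < 3" for u
    using f that by (auto simp: bij_betw_def)
  have d: "f 0 \<noteq> f 1" "f 1 \<noteq> f 2" "f 0 \<noteq> f 2" using inj[of 0 1] inj[of 1 2] inj[of 0 2] by simp_all
  have e: "{f 0, f 1} \<in> edges H" "{f 1, f 2} \<in> edges H" "{f 0, f 2} \<in> edges H"
    using E[of 0 1] E[of 1 2] E[of 0 2] by simp_all
  have "\<chi> {f 0, f 1} \<noteq> \<chi> {f 1, f 2}" "\<chi> {f 1, f 2} \<noteq> \<chi> {f 0, f 2}" "\<chi> {f 0, f 1} \<noteq> \<chi> {f 0, f 2}"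
    using inj_on_eq_iff[OF H(2) e(1) e(2)] inj_on_eq_iff[OF H(2) e(2) e(3)]
      inj_on_eq_iff[OF H(2) e(1) e(3)] d by (auto simp: doubleton_eq_iff)
  then show "\<not> rainbow_triangle_free {..<n} \<chi>"
    using rainbow_triangle_freeD[of "{..<n}" \<chi> "f 0" "f 1" "f 2"] mem[of 0] mem[of 1] mem[of 2] d by auto
next
  assume "\<not> rainbow_triangle_free {..<n} \<chi>"
  then obtain x y z where xyz: "x < n" "y < n" "z < n" "x \<noteq> y" "y \<noteq> z" "x \<noteq> z"
    and c: "\<chi> {x, y} \<noteq> \<chi> {y, z}" "\<chi> {y, z} \<noteq> \<chi> {x, z}" "\<chi> {x, y} \<noteq> \<chi> {x, z}"
    unfolding rainbow_triangle_free_def by auto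
  define H where "H = \<lparr>verts = {x, y, z}, edges = {{x, y}, {y, z}, {x, z}}\<rparr>"
  define f where "f = (\<lambda>i :: nat. if i = 0 then x else if i = 1 then y else z)"
  have three: "{..<3 :: nat} = {0, 1, 2}" by auto
  have "subgraph_of H (complete_graph n)"
    using xyz by (auto simp: subgraph_of_def simple_graph_def H_def complete_graph_def nsets_def)
  moreover have "graph_iso (complete_graph 3) H"
    unfolding graph_iso_def
  proof (intro exI[of _ f] conjI ballI)
    show "bij_betw f (verts (complete_graph 3)) (verts H)"
      using xyz by (auto simp: complete_graph_def three H_def bij_betw_def inj_on_def f_def)
    fix u v assume "u \<in> verts (complete_graph 3)" "v \<in> verts (complete_graph 3)"
    then have "u = 0 \<or> u = 1 \<or> u = 2" "v = 0 \<or> v = 1 \<or> v = 2"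
      by (auto simp: complete_graph_def three)
    then show "({u, v} \<in> edges (complete_graph 3)) = ({f u, f v} \<in> edges H)"
      using xyz
      by (elim disjE) (simp_all add: complete_graph_def nsets_def H_def f_def doubleton_eq_iff)
  qed
  moreover have "rainbow H \<chi>" using c by (auto simp: rainbow_def H_def)
  ultimately show "\<exists>H. copy_in (complete_graph 3) (complete_graph n) H \<and> rainbow H \<chi>"
    by (auto simp: copy_in_def)
qed

section \<open>Both numbers in terms of colorings, and the upper bound for two colors\<close>

definition two_color_arrows :: "nat \<Rightarrow> nat \<Rightarrow> nat \<Rightarrow> bool" where
  "two_color_arrows n s t \<longleftrightarrow> (\<forall>\<chi> :: nat set \<Rightarrow> nat.
     (\<forall>x<n. \<forall>y<n. x \<noteq> y \<longrightarrow> \<chi> {x, y} \<in> {0, 1}) \<longrightarrow> has_ordered_biclique {..<n} \<chi> s t)"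

lemma image_edges_complete_graph:
  "\<chi> ` edges (complete_graph n) \<subseteq> K \<longleftrightarrow> (\<forall>x<n. \<forall>y<n. x \<noteq> y \<longrightarrow> \<chi> {x, y} \<in> K)"
proof -
  have "edges (complete_graph n) = {{x, y} | x y. x < n \<and> y < n \<and> x \<noteq> y}"
    by (auto simp: complete_graph_def nsets_def card_2_iff)
  then show ?thesis unfolding image_subset_iff by (simp only:) blast
qed

lemma r2'_eq: "r2' (complete_bipartite s t) = (LEAST n. two_color_arrows n s t)"
  unfolding r2'_def copy_complete_bipartite_iff image_edges_complete_graph two_color_arrows_def ..

lemma CR_eq:
  "CR (complete_bipartite s t) (complete_graph 3) =
     (LEAST n. \<forall>\<chi> :: nat set \<Rightarrow> nat. rainbow_triangle_free {..<n} \<chi> \<longrightarrow> has_ordered_biclique {..<n} \<chi> s t)"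
  unfolding CR_def copy_complete_bipartite_iff rainbow_triangle_copy_iff
  by (rule arg_cong[of _ _ Least]) blast

lemma two_color_arrows_mono:
  assumes "two_color_arrows n s t" "n \<le> n'"
  shows "two_color_arrows n' s t"
  unfolding two_color_arrows_def
proof (intro allI impI)
  fix \<chi> :: "nat set \<Rightarrow> nat"
  assume "\<forall>x<n'. \<forall>y<n'. x \<noteq> y \<longrightarrow> \<chi> {x, y} \<in> {0, 1}"
  then have "has_ordered_biclique {..<n} \<chi> s t"
    using assms unfolding two_color_arrows_def by (meson less_le_trans)
  then show "has_ordered_biclique {..<n'} \<chi> s t"
    using assms(2) by (rule_tac has_ordered_biclique_mono) auto
qed

text \<open>The case \<open>k = 0\<close> of \<open>exists_many_good\<close>; the 3 is
  \<open>2 * (k + 1) + 1\<close>.\<close>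

lemma two_color_arrowsI:
  assumes "s \<le> n" "n > 0" and n: "(real s + 1) * n \<ge> 2 ^ s * (real t + real ((s + 1) * s) + 3)"
  shows "two_color_arrows n s t"
  unfolding two_color_arrows_def
proof (intro allI impI)
  fix \<chi> :: "nat set \<Rightarrow> nat"
  assume \<chi>: "\<forall>x<n. \<forall>y<n. x \<noteq> y \<longrightarrow> \<chi> {x, y} \<in> {0, 1}"
  have "other_degree \<chi> (- {0, 1}) {..<n} b \<le> 0" if "b \<in> {..<n}" for b
    using \<chi> that by (auto simp: other_degree_def)
  then obtain as cs where as: "distinct as" "as \<in> tuples {..<n} s"
    and "(real s + 1) * card {..<n} \<le>
      2 ^ s * (card (good_for \<chi> {..<n} as cs) + real ((s + 1) * s) + 2 * real (0 + 1) + 1)"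
    using exists_many_good[of "{..<n}" s 0 1 \<chi> 0] assms by auto
  then have "2 ^ s * (real t + real ((s + 1) * s) + 3) \<le>
      2 ^ s * (card (good_for \<chi> {..<n} as cs) + real ((s + 1) * s) + 2 * real (0 + 1) + 1)"
    using n by (simp only: card_lessThan)
  then have "real t + real ((s + 1) * s) + 3 \<le>
      card (good_for \<chi> {..<n} as cs) + real ((s + 1) * s) + 2 * real (0 + 1) + 1"
    by (simp only: mult_le_cancel_left_pos zero_less_power zero_less_numeral)
  then have "t \<le> card (good_for \<chi> {..<n} as cs)" by simp
  then show "has_ordered_biclique {..<n} \<chi> s t"
    using as unfolding has_ordered_biclique_def tuples_def by blast
qed

lemma pow2_ge_Suc: "real s + 1 \<le> 2 ^ s"
proof -
  have "Suc s \<le> 2 ^ s" by (induction s) auto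
  then have "real (Suc s) \<le> real (2 ^ s)" by (rule of_nat_mono)
  then show ?thesis by simp
qed

text \<open>Serves twice: the \<open>LEAST\<close> defining \<open>r2'\<close> is attained, and the
  upper bound follows.\<close>

lemma two_color_arrows_ceiling:
  "two_color_arrows (nat \<lceil>2 ^ s / (real s + 1) * (real t + real ((s + 1) * s) + 3)\<rceil>) s t"
proof (rule two_color_arrowsI)
  define M where "M = real t + real ((s + 1) * s) + 3"
  define x where "x = 2 ^ s / (real s + 1) * M"
  have "M \<ge> 3" by (simp add: M_def)
  have "2 ^ s / (real s + 1) \<ge> 1" using pow2_ge_Suc by simp
  then have "1 * M \<le> x" unfolding x_def using \<open>M \<ge> 3\<close> by (intro mult_right_mono) auto
  then have x: "x \<ge> M" by simp
  have "real s \<le> M" by (simp add: M_def algebra_simps)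
  then show "s \<le> nat \<lceil>2 ^ s / (real s + 1) * (real t + real ((s + 1) * s) + 3)\<rceil>"
    "0 < nat \<lceil>2 ^ s / (real s + 1) * (real t + real ((s + 1) * s) + 3)\<rceil>"
    using x \<open>M \<ge> 3\<close> unfolding x_def[symmetric] M_def[symmetric] by linarith+
  have "real (nat \<lceil>x\<rceil>) \<ge> x" by (rule real_nat_ceiling_ge)
  then have "(real s + 1) * real (nat \<lceil>x\<rceil>) \<ge> (real s + 1) * x" by (intro mult_left_mono) auto
  also have "(real s + 1) * x = 2 ^ s * M" by (simp add: x_def)
  finally show "(real s + 1) * real (nat \<lceil>2 ^ s / (real s + 1) * (real t + real ((s + 1) * s) + 3)\<rceil>)
      \<ge> 2 ^ s * (real t + real ((s + 1) * s) + 3)"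
    unfolding x_def[symmetric] M_def[symmetric] by simp
qed

subsection \<open>Colorings with at least three colors\<close>

text \<open>The square is the surplus over \<open>s + 1\<close> of the plain average, the bracket
  that of the twins, which a bias can make negative. Completing the square costs
  \<open>(\<rho> * a * b)^2 / 4\<close>, and \<open>\<rho> = 1 / s ^ 3\<close> is small enough to
  keep this below a quarter of \<open>\<rho> * a\<close>.\<close>

lemma twin_weight_bound:
  fixes s :: nat and \<omega> :: real
  assumes "s \<ge> 2"
  defines "\<rho> \<equiv> 1 / real s ^ 3"
  shows "\<omega>\<^sup>2 + \<rho> * ((real s - 1) + \<omega> * (real s - 2) * (real s - 1)) \<ge> \<rho> / 2"
proof -
  define a where "a = real s - 1"
  define b where "b = real s - 2"
  have ab: "a \<ge> 1" "b \<ge> 0" "a \<le> real s" "b \<le> real s" using assms(1) by (auto simp: a_def b_def)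
  have s: "real s \<ge> 2" using assms(1) by simp
  have \<rho>: "\<rho> > 0" using s by (simp add: \<rho>_def)
  have "0 \<le> (\<omega> + \<rho> * a * b / 2)\<^sup>2" by simp
  then have 1: "\<omega>\<^sup>2 + \<rho> * (\<omega> * b * a) \<ge> - (\<rho> * a * b)\<^sup>2 / 4"
    by (simp add: power2_eq_square algebra_simps)
  have "a * b\<^sup>2 \<le> real s * (real s)\<^sup>2" using ab by (intro mult_mono power_mono) auto
  then have "\<rho> * (a * b\<^sup>2) \<le> \<rho> * (real s * (real s)\<^sup>2)" using \<rho> by (intro mult_left_mono) auto
  also have "\<rho> * (real s * (real s)\<^sup>2) = 1" using s by (simp add: \<rho>_def power3_eq_cube power2_eq_square)
  finally have "(\<rho> * a) * (\<rho> * (a * b\<^sup>2)) \<le> (\<rho> * a) * 1" using \<rho> ab by (intro mult_left_mono) auto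
  then have 2: "(\<rho> * a * b)\<^sup>2 \<le> \<rho> * a" by (simp add: power2_eq_square algebra_simps)
  have 3: "\<rho> * a \<ge> \<rho> * 1" using \<rho> ab by (intro mult_left_mono) auto
  have combine: "x + y + z \<ge> r / 2"
    if "z \<ge> r * 1" "x + y \<ge> - q / 4" "q \<le> z" "z \<ge> 0" for x y z q r :: real
    using that by linarith
  have "\<omega>\<^sup>2 + \<rho> * (\<omega> * b * a) + \<rho> * a \<ge> \<rho> / 2"
  proof -
    have z: "\<rho> * a \<ge> 0" using \<rho> ab by simp
    show ?thesis by (rule combine[OF 3 1 2 z])
  qed
  then show ?thesis by (simp add: a_def b_def algebra_simps)
qed

text \<open>Placing twins at the end of the tuple beats the average, unless the two colors are
  unbalanced at many vertices, and then the average itself is too large.\<close>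

lemma twins_imp_biclique:
  fixes \<chi> :: "'a set \<Rightarrow> nat"
  assumes V: "finite V" and s: "s \<ge> 2" and c: "c1 \<noteq> c2"
    and deg: "\<And>u. u \<in> V \<Longrightarrow> other_degree \<chi> (- {c1, c2}) V u \<le> 3 * s"
    and X: "homogeneous \<chi> V X" "card X \<ge> 2" "card X \<le> s"
    and n: "2 ^ s * real t \<le> (real s + 1) * card V + card V / (8 * real s ^ 3)"
    and large: "real (card V) > 8 * real s ^ 3 * (2 ^ s * real ((s + 1) * s) + 2 ^ (s + 2) * real (3 * s + 1)
      + 4 * real s * (real s + 1)) + 8 * real s"
  shows "has_ordered_biclique V \<chi> s t"
proof (rule ccontr)
  assume no: "\<not> has_ordered_biclique V \<chi> s t"
  define k where "k = 3 * s + 1"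
  define K where "K = {c1, c2}"
  define n where "n = real (card V)"
  have "0 \<le> 8 * real s ^ 3 * (2 ^ s * real ((s + 1) * s) + 2 ^ (s + 2) * real (3 * s + 1)
      + 4 * real s * (real s + 1)) + 8 * real s"
    by (intro add_nonneg_nonneg mult_nonneg_nonneg) auto
  then have "real (card V) > 0" using large by linarith
  then have V_ne: "V \<noteq> {}" by auto
  have n_pos: "n > 0" using V V_ne by (simp add: n_def card_gt_0_iff)
  have few: "card (good_for \<chi> V as cs) \<le> t" if "distinct as" "set as \<subseteq> V" "length as = s" for as cs
  proof -
    have "\<not> t \<le> card (good_for \<chi> V as cs)"
      using no that unfolding has_ordered_biclique_def by blast
    then show ?thesis by simp
  qed
  have other: "card {a \<in> V. \<chi> {b, a} \<notin> {c1, c2}} \<le> k" if "b \<in> V" for b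
    unfolding k_def using card_other_le[OF V deg[OF that]] .
  have X_sub: "X \<subseteq> V" using X(1) by (auto simp: homogeneous_def)
  obtain Y where "Y \<subseteq> X" "card Y = 2" using obtain_subset_with_card_n[OF X(2)] by blast
  then obtain u v where uv: "u \<in> X" "v \<in> X" "u \<noteq> v" by (auto simp: card_2_iff)
  \<comment> \<open>To the vertices of \<open>B\<close>, \<open>u\<close> and \<open>v\<close> are
    twins in one of the two main colors. At most \<open>4 * s\<close> vertices are lost:
    \<open>s\<close> in \<open>X\<close> and \<open>3 * s\<close> joined to \<open>u\<close> in
    other colors.\<close>
  define B where "B = {b \<in> V - X. \<chi> {b, u} \<in> K}"
  have B_sub: "B \<subseteq> V" by (auto simp: B_def)
  then have finB: "finite B" using V finite_subset by blast
  have twin: "\<chi> {b, v} = \<chi> {b, u}" if "b \<in> B" for b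
  proof -
    have "b \<in> V - X" using that by (simp add: B_def)
    then obtain c where "\<And>x. x \<in> X \<Longrightarrow> \<chi> {b, x} = c" using X(1) unfolding homogeneous_def by blast
    then show ?thesis using uv by simp
  qed
  have card_B: "real (card B) \<ge> n - 4 * real s"
  proof -
    have "V \<subseteq> B \<union> X \<union> {w \<in> V. w \<noteq> u \<and> \<chi> {u, w} \<in> - {c1, c2}}"
      using uv by (auto simp: B_def K_def insert_commute)
    then have "card V \<le> card (B \<union> X \<union> {w \<in> V. w \<noteq> u \<and> \<chi> {u, w} \<in> - {c1, c2}})"
      using finB V X_sub finite_subset by (intro card_mono) auto
    also have "\<dots> \<le> card B + card X + other_degree \<chi> (- {c1, c2}) V u"
      unfolding other_degree_def by (meson card_Un_le le_trans add_right_mono)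
    also have "\<dots> \<le> card B + s + 3 * s" using X(3) deg[of u] uv X_sub by (intro add_mono) auto
    finally show ?thesis by (simp add: n_def)
  qed
  define p where "p = (\<lambda>b c. real (card {a \<in> V. \<chi> {b, a} = c}) / real (card V))"
  \<comment> \<open>The bias of \<open>b\<close> toward the color that it sends to the twins, be it
    \<open>c1\<close> or \<open>c2\<close>; that color takes the first place in both bounds.\<close>
  define \<omega> where "\<omega> = (\<lambda>b. 2 * p b (\<chi> {b, u}) - 1)"
  have count: "good_count K V (\<lambda>a. \<chi> {b, a}) [] [] s \<ge>
      (real s + 1 + (\<omega> b)\<^sup>2 - 2 ^ (s + 2) * (k / n)) * n ^ s" (is ?G)
    and count_twins: "good_count K V (\<lambda>a. \<chi> {b, a}) [c1, c1] (pattern \<chi> [u, v] b) (s - 2) \<ge>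
      (1 + real (s - 2) / 2 + \<omega> b * real (s - 2) * (real (s - 2) + 1) / 4 - 2 ^ (s - 2) * (k / n)) * n ^ (s - 2)" (is ?H)
    if "b \<in> B" for b
  proof -
    have b: "b \<in> V" "\<chi> {b, u} = c1 \<or> \<chi> {b, u} = c2" using that by (auto simp: B_def K_def)
    have K': "{c1, c2} = {c2, c1}" by auto
    have o1: "card {a \<in> V. \<chi> {b, a} \<notin> {c1, c2}} \<le> k" by (rule other[OF b(1)])
    have o2: "card {a \<in> V. \<chi> {b, a} \<notin> {c2, c1}} \<le> k" using o1 by (simp only: K')
    have pat: "pattern \<chi> [u, v] b = [\<chi> {b, u}, \<chi> {b, u}]" using twin[OF that] by simp
    show ?G
      using b(2)
    proof
      assume "\<chi> {b, u} = c1"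
      then show ?thesis
        using good_count_free_strong[OF V V_ne c o1 s] by (simp add: K_def \<omega>_def p_def n_def)
    next
      assume "\<chi> {b, u} = c2"
      then show ?thesis
        using good_count_free_strong[OF V V_ne c[symmetric] o2 s] by (simp add: K_def K' \<omega>_def p_def n_def)
    qed
    show ?H
      using b(2)
    proof
      assume "\<chi> {b, u} = c1"
      then show ?thesis
        using good_count_twins[OF V V_ne c o1, of "[c1, c1]" "s - 2"] unfolding pat
        by (simp add: K_def \<omega>_def p_def n_def)
    next
      assume "\<chi> {b, u} = c2"
      then show ?thesis
        using good_count_twins[OF V V_ne c[symmetric] o2, of "[c1, c1]" "s - 2"] unfolding pat
        by (simp add: K_def K' \<omega>_def p_def n_def)
    qed
  qed
  have cardK: "card K = 2" using c by (simp add: K_def)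
  have finK: "finite K" by (simp add: K_def)
  define C where "C = 2 ^ s * real ((s + 1) * s) + 2 ^ (s + 2) * real k"
  have le1: "(\<Sum>b\<in>B. real s + 1 + (\<omega> b)\<^sup>2) \<le> 2 ^ s * real t + C"
  proof -
    have "(\<Sum>b\<in>B. (real s + 1 + (\<omega> b)\<^sup>2 - 2 ^ (s + 2) * (k / n)) * n ^ s) \<le>
        (\<Sum>b\<in>B. good_count K V (\<lambda>a. \<chi> {b, a}) [] (pattern \<chi> [] b) s)"
      using count by (intro sum_mono) simp
    also have "\<dots> \<le> (real (card K) * real (card V)) ^ s * (real t + real ((s + 1) * (s + length ([] :: 'a list))))"
    proof (rule sum_good_count_le[OF V B_sub _ finK])
      fix as cs assume as: "as \<in> tuples V s" "distinct (as @ [])"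
      have "card (good_for \<chi> B as cs) \<le> card (good_for \<chi> V as cs)"
        using B_sub by (intro card_mono finite_good_for[OF V]) (auto simp: good_for_def)
      also have "\<dots> \<le> t" using as by (intro few) (auto simp: tuples_def)
      finally show "real (card (good_for \<chi> B (as @ []) (cs @ []))) \<le> real t" by simp
    qed auto
    also have "\<dots> = n ^ s * (2 ^ s * (real t + real ((s + 1) * s)))"
      by (simp add: cardK n_def power_mult_distrib)
    also have "(\<Sum>b\<in>B. (real s + 1 + (\<omega> b)\<^sup>2 - 2 ^ (s + 2) * (k / n)) * n ^ s) =
        n ^ s * (\<Sum>b\<in>B. real s + 1 + (\<omega> b)\<^sup>2 - 2 ^ (s + 2) * (k / n))"
      by (simp add: sum_distrib_left mult.commute)
    finally have "(\<Sum>b\<in>B. real s + 1 + (\<omega> b)\<^sup>2 - 2 ^ (s + 2) * (k / n)) \<le> 2 ^ s * (real t + real ((s + 1) * s))"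
      using n_pos by (simp only: mult_le_cancel_left_pos zero_less_power)
    moreover have "(\<Sum>b\<in>B. real s + 1 + (\<omega> b)\<^sup>2 - 2 ^ (s + 2) * (k / n)) =
        (\<Sum>b\<in>B. real s + 1 + (\<omega> b)\<^sup>2) - real (card B) * (2 ^ (s + 2) * (k / n))"
      by (simp only: sum_subtractf sum_constant)
    moreover have "real (card B) * (2 ^ (s + 2) * (k / n)) \<le> n * (2 ^ (s + 2) * (k / n))"
      using card_mono[OF V B_sub] n_pos by (intro mult_right_mono) (auto simp: n_def)
    moreover have "n * (2 ^ (s + 2) * (k / n)) = 2 ^ (s + 2) * real k" using n_pos by simp
    moreover have "2 ^ s * (real t + real ((s + 1) * s)) = 2 ^ s * real t + 2 ^ s * real ((s + 1) * s)"
      by (rule distrib_left)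
    ultimately show ?thesis unfolding C_def by linarith
  qed
  \<comment> \<open>The twins fill two of the \<open>s\<close> places, so the count for
    \<open>s - 2\<close> entries is multiplied by 4 to reach the scale \<open>2 ^ s\<close>.\<close>
  have le2: "(\<Sum>b\<in>B. 2 * real s + \<omega> b * (real s - 2) * (real s - 1)) \<le> 2 ^ s * real t + C"
  proof -
    define r where "r = s - 2"
    have s_r: "s = r + 2" using s by (simp add: r_def)
    let ?f = "\<lambda>b. 1 + real r / 2 + \<omega> b * real r * (real r + 1) / 4"
    have "(\<Sum>b\<in>B. (?f b - 2 ^ r * (k / n)) * n ^ r) \<le>
        (\<Sum>b\<in>B. good_count K V (\<lambda>a. \<chi> {b, a}) [c1, c1] (pattern \<chi> [u, v] b) r)"
      using count_twins unfolding r_def by (intro sum_mono) blast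
    also have "\<dots> \<le> (real (card K) * real (card V)) ^ r * (real t + real ((r + 1) * (r + length [u, v])))"
    proof (rule sum_good_count_le[OF V B_sub _ finK])
      fix as cs assume as: "as \<in> tuples V r" "distinct (as @ [u, v])"
      have "card (good_for \<chi> B (as @ [u, v]) (cs @ [c1, c1])) \<le> card (good_for \<chi> V (as @ [u, v]) (cs @ [c1, c1]))"
        using B_sub by (intro card_mono finite_good_for[OF V]) (auto simp: good_for_def)
      also have "\<dots> \<le> t" using as uv X_sub by (intro few) (auto simp: tuples_def s_r)
      finally show "real (card (good_for \<chi> B (as @ [u, v]) (cs @ [c1, c1]))) \<le> real t" by simp
    qed (use uv in auto)
    also have "\<dots> = n ^ r * (2 ^ r * (real t + real ((r + 1) * s)))"
      by (simp add: cardK n_def power_mult_distrib s_r)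
    also have "(\<Sum>b\<in>B. (?f b - 2 ^ r * (k / n)) * n ^ r) = n ^ r * (\<Sum>b\<in>B. ?f b - 2 ^ r * (k / n))"
      by (simp add: sum_distrib_left mult.commute)
    finally have "(\<Sum>b\<in>B. ?f b - 2 ^ r * (k / n)) \<le> 2 ^ r * (real t + real ((r + 1) * s))"
      using n_pos by (simp only: mult_le_cancel_left_pos zero_less_power)
    moreover have "(\<Sum>b\<in>B. ?f b - 2 ^ r * (k / n)) = (\<Sum>b\<in>B. ?f b) - real (card B) * (2 ^ r * (k / n))"
      by (simp only: sum_subtractf sum_constant)
    moreover have "real (card B) * (2 ^ r * (k / n)) \<le> n * (2 ^ r * (k / n))"
      using card_mono[OF V B_sub] n_pos by (intro mult_right_mono) (auto simp: n_def)
    moreover have "n * (2 ^ r * (k / n)) = 2 ^ r * real k" using n_pos by simp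
    ultimately have "4 * (\<Sum>b\<in>B. ?f b) \<le> 4 * (2 ^ r * (real t + real ((r + 1) * s))) + 4 * (2 ^ r * real k)"
      by linarith
    also have "\<dots> = 2 ^ s * real t + 2 ^ s * real ((r + 1) * s) + 2 ^ s * real k"
      by (simp add: s_r distrib_left)
    finally have "4 * (\<Sum>b\<in>B. ?f b) \<le> 2 ^ s * real t + 2 ^ s * real ((r + 1) * s) + 2 ^ s * real k" .
    moreover have "4 * (\<Sum>b\<in>B. ?f b) = (\<Sum>b\<in>B. 2 * real s + \<omega> b * (real s - 2) * (real s - 1))"
      unfolding sum_distrib_left by (intro sum.cong refl) (simp add: s_r field_simps)
    moreover have "2 ^ s * real ((r + 1) * s) \<le> 2 ^ s * real ((s + 1) * s)"
      by (intro mult_left_mono of_nat_mono mult_le_mono1) (auto simp: s_r)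
    moreover have "2 ^ s * real k \<le> 2 ^ (s + 2) * real k" by (intro mult_right_mono) auto
    ultimately show ?thesis unfolding C_def by linarith
  qed
  define \<rho> where "\<rho> = 1 / real s ^ 3"
  \<comment> \<open>The total surplus over \<open>s + 1\<close> that either average can have without
    a copy: the assumed deficit, the counting errors, and the loss from vertices outside
    \<open>B\<close>.\<close>
  define Q where "Q = n / (8 * real s ^ 3) + C + 4 * real s * (real s + 1)"
  have s_real: "real s \<ge> 2" using s by simp
  have \<rho>: "\<rho> > 0" "\<rho> \<le> 1" using s_real by (auto simp: \<rho>_def)
  have "(real s + 1) * (n - 4 * real s) \<le> (real s + 1) * card B"
    using card_B by (intro mult_left_mono) auto
  then have Q_ge: "2 ^ s * real t + C \<le> (real s + 1) * card B + Q"
    using n by (simp add: Q_def n_def algebra_simps)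
  have "(\<Sum>b\<in>B. real s + 1 + (\<omega> b)\<^sup>2) = (real s + 1) * card B + (\<Sum>b\<in>B. (\<omega> b)\<^sup>2)"
    by (simp add: sum.distrib)
  then have q1: "(\<Sum>b\<in>B. (\<omega> b)\<^sup>2) \<le> Q" using le1 Q_ge by linarith
  have "(\<Sum>b\<in>B. 2 * real s + \<omega> b * (real s - 2) * (real s - 1)) =
      (\<Sum>b\<in>B. (real s + 1) + ((real s - 1) + \<omega> b * (real s - 2) * (real s - 1)))"
    by (intro sum.cong) auto
  also have "\<dots> = (real s + 1) * card B + (\<Sum>b\<in>B. (real s - 1) + \<omega> b * (real s - 2) * (real s - 1))"
    by (simp only: sum.distrib sum_constant) (simp add: algebra_simps)
  finally have q2: "(\<Sum>b\<in>B. (real s - 1) + \<omega> b * (real s - 2) * (real s - 1)) \<le> Q"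
    using le2 Q_ge by linarith
  \<comment> \<open>The main terms are \<open>n * \<rho> / 2\<close> on the left and, since
    \<open>Q\<close> is about \<open>n * \<rho> / 8\<close>, only \<open>n * \<rho> / 4\<close> on
    the right; \<open>large\<close> absorbs the rest.\<close>
  have "card B * (\<rho> / 2) = (\<Sum>b\<in>B. \<rho> / 2)" by simp
  also have "\<dots> \<le> (\<Sum>b\<in>B. (\<omega> b)\<^sup>2 + \<rho> * ((real s - 1) + \<omega> b * (real s - 2) * (real s - 1)))"
    unfolding \<rho>_def by (intro sum_mono twin_weight_bound[OF s])
  also have "\<dots> = (\<Sum>b\<in>B. (\<omega> b)\<^sup>2) + \<rho> * (\<Sum>b\<in>B. (real s - 1) + \<omega> b * (real s - 2) * (real s - 1))"
    unfolding sum_distrib_left by (rule sum.distrib)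
  also have "\<dots> \<le> Q + \<rho> * Q" using q1 q2 \<rho> by (intro add_mono mult_left_mono) auto
  also have "\<dots> \<le> Q + 1 * Q"
  proof -
    have "Q \<ge> 0" using n_pos by (simp add: Q_def C_def)
    then show ?thesis using \<rho> by (intro add_mono mult_right_mono) auto
  qed
  finally have "card B * (\<rho> / 2) \<le> 2 * Q" by simp
  moreover have "(n - 4 * real s) * (\<rho> / 2) \<le> card B * (\<rho> / 2)"
    using card_B \<rho> by (intro mult_right_mono) auto
  ultimately have "(n - 4 * real s) * (\<rho> / 2) \<le> 2 * Q" by linarith
  then have le: "(n - 4 * real s) * (\<rho> / 2) * (4 * real s ^ 3) \<le> 2 * Q * (4 * real s ^ 3)"
    by (intro mult_right_mono) auto
  define W where "W = 8 * real s ^ 3 * (C + 4 * real s * (real s + 1))"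
  have "(n - 4 * real s) * (\<rho> / 2) * (4 * real s ^ 3) = 2 * (n - 4 * real s)"
    using s_real by (simp add: \<rho>_def)
  moreover have "2 * Q * (4 * real s ^ 3) = n + W"
    using s_real by (simp add: Q_def W_def field_simps)
  ultimately have "2 * (n - 4 * real s) \<le> n + W" using le by (simp only:)
  then have "n \<le> W + 8 * real s" by (simp add: algebra_simps)
  moreover have "n > W + 8 * real s" using large unfolding n_def C_def W_def k_def .
  ultimately show False by simp
qed

text \<open>The size required by \<open>twins_imp_biclique\<close> plus the size that refutes a
  proper \<open>D\<close>, so that both are exceeded.\<close>

definition gallai_threshold :: "nat \<Rightarrow> real" where
  "gallai_threshold s = 8 * real s ^ 3 * (2 ^ s * real ((s + 1) * s) + 2 ^ (s + 2) * real (3 * s + 1)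
      + 4 * real s * (real s + 1)) + 8 * real s
    + 2 * (2 * real s + 1) * (2 ^ s * (real ((s + 1) * s) + 2 * real (3 * s + 1) + 1))"

text \<open>Take a smallest homogeneous set \<open>D\<close> with at least \<open>s\<close> vertices. Choosing the \<open>s\<close>-side inside
  \<open>D\<close> makes all outside vertices good, so few vertices lie outside. Putting one outside vertex first
  and the rest in \<open>D\<close> gains a factor \<open>2s/(s+1)\<close> over the average, so \<open>D\<close> is everything, and then
  small homogeneous sets yield twins.\<close>

lemma three_colors_imp_biclique:
  fixes \<chi> :: "'a set \<Rightarrow> nat"
  assumes V: "finite V" and s: "s \<ge> 2" and free: "rainbow_triangle_free V \<chi>"
    and colors: "\<not> (\<exists>c c'. \<chi> ` {{x, y} | x y. x \<in> V \<and> y \<in> V \<and> x \<noteq> y} \<subseteq> {c, c'})"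
    and n: "2 ^ s * real t \<le> (real s + 1) * card V + card V / (8 * real s ^ 3)"
    and large: "real (card V) > gallai_threshold s"
  shows "has_ordered_biclique V \<chi> s t"
proof (rule ccontr)
  assume no: "\<not> has_ordered_biclique V \<chi> s t"
  define C where "C = 2 ^ s * (real ((s + 1) * s) + 2 * real (3 * s + 1) + 1)"
  define n where "n = real (card V)"
  define \<epsilon> where "\<epsilon> = 1 / (8 * real s ^ 3)"
  have s_real: "real s \<ge> 2" using s by simp
  have large1: "n > 8 * real s ^ 3 * (2 ^ s * real ((s + 1) * s) + 2 ^ (s + 2) * real (3 * s + 1)
      + 4 * real s * (real s + 1)) + 8 * real s" (is "_ > ?L")
    and large2: "n > 2 * (2 * real s + 1) * C" and large3: "n \<ge> real s"
  proof -
    have nn: "2 * (2 * real s + 1) * C \<ge> 0" "?L \<ge> 8 * real s" by (simp_all add: C_def)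
    have "n > ?L + 2 * (2 * real s + 1) * C" using large by (simp add: n_def gallai_threshold_def C_def)
    then show "n > ?L" "n > 2 * (2 * real s + 1) * C" "n \<ge> real s" using nn s_real by linarith+
  qed
  have n': "2 ^ s * real t \<le> (real s + 1) * n + \<epsilon> * n"
    using n by (simp add: n_def \<epsilon>_def)
  have few: "card (good_for \<chi> V as cs) < t" if "distinct as" "set as \<subseteq> V" "length as = s" for as cs
  proof -
    have "\<not> t \<le> card (good_for \<chi> V as cs)"
      using no that unfolding has_ordered_biclique_def by blast
    then show ?thesis by simp
  qed
  define M where "M = {X. homogeneous \<chi> V X \<and> s \<le> card X}"
  have "V \<in> M" using large3 by (auto simp: M_def homogeneous_def n_def)
  then obtain D where D: "D \<in> M" and D_min: "\<And>X. X \<in> M \<Longrightarrow> card D \<le> card X"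
    using ex_has_least_nat[of "\<lambda>X. X \<in> M" V card] by blast
  have D_hom: "homogeneous \<chi> V D" and D_card: "s \<le> card D" using D by (auto simp: M_def)
  have D_sub: "D \<subseteq> V" using D_hom by (simp add: homogeneous_def)
  then have finD: "finite D" using V finite_subset by blast
  \<comment> \<open>Homogeneity is transitive, so such an \<open>X\<close> with \<open>s\<close>
    vertices would contradict the minimality of \<open>D\<close>.\<close>
  have small: "card X < s" if "homogeneous \<chi> D X" "X \<noteq> D" for X
  proof (rule ccontr)
    assume "\<not> card X < s"
    then have "X \<in> M" using homogeneous_trans[OF D_hom that(1)] by (simp add: M_def)
    moreover have "card X < card D"
      using that finD by (intro psubset_card_mono) (auto simp: homogeneous_def)
    ultimately show False using D_min by fastforce
  qed
  have D_ne: "D \<noteq> {}" using D_card s by auto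
  have freeD: "rainbow_triangle_free D \<chi>" using rainbow_triangle_free_subset[OF free D_sub] .
  have "card D \<ge> 2" using D_card s by simp
  then obtain c1 c2 where c: "c1 \<noteq> c2"
    and deg: "\<And>u. u \<in> D \<Longrightarrow> other_degree \<chi> (- {c1, c2}) D u \<le> 3 * s"
    using almost_two_colors[OF finD _ freeD, of s] small less_imp_le by metis
  show False
  proof (cases "D = V")
    case True
    obtain X where X: "homogeneous \<chi> V X" "card X \<ge> 2" "X \<noteq> V"
      using proper_homogeneous[OF V free colors] by blast
    have "card X \<le> s" using small[of X] X True by simp
    then show False
      using twins_imp_biclique[OF V s c _ X(1,2) _ n] deg True large1 no by (simp only: n_def) blast
  next
    case False
    then obtain v where v: "v \<in> V - D" using D_sub by blast
    then obtain c where c_v: "\<And>x. x \<in> D \<Longrightarrow> \<chi> {v, x} = c"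
      using D_hom unfolding homogeneous_def by blast
    define m where "m = real (card (V - D))"
    have n_m: "n = m + real (card D)"
      using card_Diff_subset[OF finD D_sub] card_mono[OF V D_sub] by (simp add: n_def m_def)
    have small_outside: "m \<le> \<epsilon> * n + C"
    proof -
      obtain as cs where as: "distinct as" "as \<in> tuples D s" "length cs = s"
        and ge: "(real s + 1) * card D \<le> 2 ^ s * (card (good_for \<chi> D as cs)
          + real ((s + 1) * s) + 2 * real (3 * s + 1) + 1)"
        using exists_many_good[OF finD D_card D_ne c deg] by blast
      have "good_for \<chi> D as cs \<union> (V - D) \<subseteq> good_for \<chi> V as cs"
      proof
        fix b assume b: "b \<in> good_for \<chi> D as cs \<union> (V - D)"
        show "b \<in> good_for \<chi> V as cs"
        proof (cases "b \<in> D")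
          case True
          then show ?thesis using b D_sub by (auto simp: good_for_def)
        next
          case False
          then have "b \<in> V - D" using b by (auto simp: good_for_def)
          then obtain z where "\<And>x. x \<in> D \<Longrightarrow> \<chi> {b, x} = z"
            using D_hom unfolding homogeneous_def by blast
          then have "good cs (pattern \<chi> as b)"
            using as by (intro good_const[where z = z]) (auto simp: tuples_def)
          then show ?thesis using \<open>b \<in> V - D\<close> as by (auto simp: good_for_def tuples_def)
        qed
      qed
      then have "card (good_for \<chi> D as cs \<union> (V - D)) \<le> card (good_for \<chi> V as cs)"
        by (intro card_mono finite_good_for[OF V])
      also have "card (good_for \<chi> D as cs \<union> (V - D)) = card (good_for \<chi> D as cs) + card (V - D)"
        using V finD by (intro card_Un_disjoint finite_good_for) (auto simp: good_for_def)
      also have "card (good_for \<chi> V as cs) < t"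
        using as D_sub by (intro few) (auto simp: tuples_def)
      finally have "real (card (good_for \<chi> D as cs)) + m \<le> real t" by (simp add: m_def)
      then have "2 ^ s * (real (card (good_for \<chi> D as cs)) + m) \<le> 2 ^ s * real t"
        by (intro mult_left_mono) auto
      moreover have "2 ^ s * (card (good_for \<chi> D as cs) + real ((s + 1) * s) + 2 * real (3 * s + 1) + 1)
          = 2 ^ s * real (card (good_for \<chi> D as cs)) + C"
        by (simp add: C_def algebra_simps)
      then have "(real s + 1) * card D \<le> 2 ^ s * real (card (good_for \<chi> D as cs)) + C" using ge by simp
      moreover have "2 ^ s * (real (card (good_for \<chi> D as cs)) + m) =
          2 ^ s * real (card (good_for \<chi> D as cs)) + 2 ^ s * m"
        by (rule distrib_left)
      \<comment> \<open>An outside vertex is always good and counts \<open>2 ^ s\<close> instead of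
        the average \<open>s + 1\<close>. The excess is at least 1 because \<open>s \<ge> 2\<close>,
        and this bounds \<open>m\<close>.\<close>
      moreover have "2 ^ s * m \<ge> (real s + 1) * m + m"
      proof -
        have "2 ^ s \<ge> s + 2" using s by (induction s rule: dec_induct) auto
        then have "real (2 ^ s) \<ge> real (s + 2)" by (rule of_nat_mono)
        then have "2 ^ s * m \<ge> (real s + 2) * m" by (intro mult_right_mono) (auto simp: m_def)
        then show ?thesis by (simp add: algebra_simps)
      qed
      ultimately have "(real s + 1) * card D + ((real s + 1) * m + m) \<le> (real s + 1) * n + \<epsilon> * n + C"
        using n' by linarith
      then show ?thesis by (simp add: n_m algebra_simps)
    qed
    have "2 * real s * card D \<le> (real s + 1) * n + \<epsilon> * n + C"
    proof -
      define r where "r = s - 1"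
      have s_r: "s = Suc r" using s by (simp add: r_def)
      have "r \<le> card D" using D_card by (simp add: s_r)
      then obtain as cs where as: "distinct as" "as \<in> tuples D r" "length cs = r"
        and ge: "(real r + 1) * card D \<le> 2 ^ r * (card (good_for \<chi> D as cs)
          + real ((r + 1) * r) + 2 * real (3 * s + 1) + 1)"
        using exists_many_good[OF finD _ D_ne c deg] by blast
      \<comment> \<open>Every vertex of \<open>D\<close> matches \<open>c\<close> at
        \<open>v\<close>, so \<open>v\<close> costs nothing: the proportion of good vertices is that
        of \<open>s - 1\<close> entries, \<open>s / 2 ^ (s - 1)\<close>.\<close>
      have "good_for \<chi> D as cs \<subseteq> good_for \<chi> V (v # as) (c # cs)"
      proof
        fix b assume b: "b \<in> good_for \<chi> D as cs"
        then have "\<chi> {b, v} = c" using c_v[of b] by (simp add: good_for_def insert_commute)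
        then show "b \<in> good_for \<chi> V (v # as) (c # cs)"
          using b v D_sub by (auto simp: good_for_def)
      qed
      then have "card (good_for \<chi> D as cs) \<le> card (good_for \<chi> V (v # as) (c # cs))"
        by (intro card_mono finite_good_for[OF V])
      also have "\<dots> < t"
        using as D_sub v by (intro few) (auto simp: tuples_def s_r)
      finally have lt: "real (card (good_for \<chi> D as cs)) \<le> real t" by simp
      have "2 * ((real r + 1) * card D) \<le> 2 * (2 ^ r * (card (good_for \<chi> D as cs)
          + real ((r + 1) * r) + 2 * real (3 * s + 1) + 1))"
        using ge by (rule mult_left_mono) simp
      also have "\<dots> = 2 ^ s * (card (good_for \<chi> D as cs) + real ((r + 1) * r) + 2 * real (3 * s + 1) + 1)"
        by (simp add: s_r)
      also have "\<dots> \<le> 2 ^ s * (real t + real ((s + 1) * s) + 2 * real (3 * s + 1) + 1)"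
        using lt by (intro mult_left_mono add_mono of_nat_mono mult_le_mono) (auto simp: s_r)
      also have "\<dots> = 2 ^ s * real t + C" by (simp add: C_def algebra_simps)
      finally show ?thesis using n' by (simp add: s_r algebra_simps)
    qed
    moreover have "2 * real s * m \<le> 2 * real s * (\<epsilon> * n + C)"
      using small_outside by (intro mult_left_mono) auto
    moreover have "2 * real s * n = 2 * real s * m + 2 * real s * card D"
      by (simp add: n_m distrib_left)
    \<comment> \<open>The gain of \<open>s - 1\<close> per vertex is at least 1, whereas the slack
      takes only \<open>(2 * s + 1) * \<epsilon> \<le> 1 / 2\<close> of it; so \<open>n\<close>
      would be bounded in terms of \<open>s\<close>.\<close>
    ultimately have "(real s - 1) * n \<le> (2 * real s + 1) * (\<epsilon> * n) + (2 * real s + 1) * C"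
      by (simp add: algebra_simps)
    moreover have "(real s - 1) * n \<ge> 1 * n"
      using s_real large3 by (intro mult_right_mono) auto
    moreover have "(2 * real s + 1) * (\<epsilon> * n) \<le> n / 2"
    proof -
      have "real s * 4 \<le> real s * (real s * real s)"
        using s_real mult_mono[of 2 "real s" 2 "real s"] by (intro mult_left_mono) auto
      then have "2 * real s + 2 * real s + 2 \<le> 8 * (real s * (real s * real s))"
        using s_real by linarith
      then have "2 * (2 * real s + 1) \<le> 8 * real s ^ 3" unfolding power3_eq_cube mult.assoc by argo
      then have "(2 * real s + 1) * \<epsilon> \<le> 1 / 2"
        using s_real by (simp add: \<epsilon>_def field_simps)
      then have "((2 * real s + 1) * \<epsilon>) * n \<le> 1 / 2 * n"
        using s_real large3 by (intro mult_right_mono) auto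
      then show ?thesis by (simp add: mult.assoc)
    qed
    ultimately have "n \<le> 2 * ((2 * real s + 1) * C)" by linarith
    then show False using large2 by (simp add: mult.assoc)
  qed
qed

subsection \<open>Asymptotics\<close>

lemma eventually_sqrt_ln_le:
  fixes K \<delta> :: real
  assumes "\<delta> > 0" "K > 0"
  shows "eventually (\<lambda>t :: nat. K * sqrt (real t * ln (real t)) \<le> \<delta> * real t) sequentially"
proof -
  have "((\<lambda>x :: real. ln x / x) \<longlongrightarrow> 0) at_top" by (rule ln_x_over_x_tendsto_0)
  then have "eventually (\<lambda>x :: real. ln x / x < (\<delta> / K)\<^sup>2) at_top"
    by (rule order_tendstoD) (use assms in simp)
  then have "eventually (\<lambda>t :: nat. ln (real t) / real t < (\<delta> / K)\<^sup>2) sequentially"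
    by (rule eventually_compose_filterlim[OF _ filterlim_real_sequentially])
  then show ?thesis
    using eventually_gt_at_top[of 0]
  proof eventually_elim
    case (elim t)
    then have "ln (real t) * real t \<le> (\<delta> / K)\<^sup>2 * real t * real t"
      by (intro mult_right_mono) (auto simp: field_simps)
    then have "sqrt (real t * ln (real t)) \<le> sqrt ((\<delta> / K * real t)\<^sup>2)"
      by (intro real_sqrt_le_mono) (simp add: power2_eq_square mult_ac)
    also have "\<dots> = \<delta> / K * real t" using assms by simp
    finally have "K * sqrt (real t * ln (real t)) \<le> K * (\<delta> / K * real t)"
      using assms by (intro mult_left_mono) auto
    then show ?case using assms by simp
  qed
qed

text \<open>\<Delta> makes the Chernoff factor at most \<open>1 / t ^ (s + 1)\<close>, which beats
  the number of tuples with forward colors, at most \<open>2 ^ (s * s + s) * t ^ s\<close>.\<close>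

lemma not_two_color_arrows:
  fixes s t :: nat
  assumes t: "t \<ge> 2" "real t > 2 ^ (s * s + s)"
  defines "\<Delta> \<equiv> 2 * sqrt (real s + 1) * sqrt (real t * ln (real t))"
  assumes \<Delta>: "\<Delta> \<le> real t"
  shows "\<not> two_color_arrows (nat \<lfloor>2 ^ s / (real s + 1) * (real t - \<Delta>)\<rfloor>) s t"
proof -
  define n where "n = nat \<lfloor>2 ^ s / (real s + 1) * (real t - \<Delta>)\<rfloor>"
  \<comment> \<open>The minimizer of \<open>t * \<Lambda>^2 - \<Delta> * \<Lambda>\<close>, which
    bounds the exponent; the minimum \<open>- \<Delta>^2 / (4 * t)\<close> equals
    \<open>- (s + 1) * ln t\<close>.\<close>
  define \<Lambda> where "\<Lambda> = \<Delta> / (2 * real t)"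
  have lnt: "ln (real t) > 0" using t by simp
  have \<Delta>_pos: "\<Delta> > 0" unfolding \<Delta>_def using lnt t by (intro mult_pos_pos) auto
  have \<Lambda>: "\<Lambda> > 0" "\<Lambda> \<le> 1" using \<Delta>_pos \<Delta> t by (auto simp: \<Lambda>_def)
  have sq: "\<Delta>\<^sup>2 = 4 * (real s + 1) * (real t * ln (real t))"
    using lnt by (simp add: \<Delta>_def power_mult_distrib)
  have n_le: "real n \<le> 2 ^ s / (real s + 1) * (real t - \<Delta>)"
    unfolding n_def using \<Delta> by (intro of_nat_floor) auto
  then have pn: "real n * ((real s + 1) / 2 ^ s) \<le> real t - \<Delta>"
    by (simp add: field_simps)
  have "2 ^ s / (real s + 1) * (real t - \<Delta>) \<le> 2 ^ s * real t"
    using \<Delta> \<Delta>_pos by (intro mult_mono) (auto simp: field_simps)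
  then have n_t: "real n \<le> 2 ^ s * real t" using n_le by linarith
  have exp_le: "exp \<Lambda> - 1 \<le> \<Lambda> + \<Lambda>\<^sup>2" using exp_bound[of \<Lambda>] \<Lambda> by simp
  have "real n * ((real s + 1) / 2 ^ s) * (exp \<Lambda> - 1) \<le> (real t - \<Delta>) * (\<Lambda> + \<Lambda>\<^sup>2)"
    using pn exp_le \<Lambda> \<Delta> by (intro mult_mono) auto
  also have "\<dots> \<le> (real t - \<Delta>) * \<Lambda> + real t * \<Lambda>\<^sup>2"
    using \<Delta>_pos by (simp add: algebra_simps)
  also have "\<dots> = \<Lambda> * t - \<Delta>\<^sup>2 / (4 * real t)"
    using t by (simp add: \<Lambda>_def power2_eq_square field_simps)
  also have "\<Delta>\<^sup>2 / (4 * real t) = (real s + 1) * ln (real t)"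
    using t by (simp add: sq)
  finally have "exp (real n * ((real s + 1) / 2 ^ s) * (exp \<Lambda> - 1) - \<Lambda> * t) \<le> exp (- (real s + 1) * ln (real t))"
    by (simp add: algebra_simps)
  also have "exp (- (real s + 1) * ln (real t)) = 1 / real t ^ (s + 1)"
  proof -
    have "exp (- (real s + 1) * ln (real t)) = inverse (exp (real (s + 1) * ln (real t)))"
      by (simp add: exp_minus[symmetric] algebra_simps)
    also have "exp (real (s + 1) * ln (real t)) = real t ^ (s + 1)"
      using t by (subst exp_of_nat_mult) simp
    finally show ?thesis by (simp add: inverse_eq_divide)
  qed
  finally have e: "exp (real n * ((real s + 1) / 2 ^ s) * (exp \<Lambda> - 1) - \<Lambda> * t) \<le> 1 / real t ^ (s + 1)" .
  have "real n ^ s * 2 ^ s * exp (real n * ((real s + 1) / 2 ^ s) * (exp \<Lambda> - 1) - \<Lambda> * t) \<le>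
      (2 ^ s * real t) ^ s * 2 ^ s * (1 / real t ^ (s + 1))"
    using n_t e by (intro mult_mono power_mono) auto
  also have "\<dots> = 2 ^ (s * s + s) / real t"
    using t by (simp add: power_mult_distrib power_add power_mult field_simps)
  also have "\<dots> < 1" using t by simp
  finally have less: "real n ^ s * 2 ^ s * exp (real n * ((real s + 1) / 2 ^ s) * (exp \<Lambda> - 1) - \<Lambda> * t) < 1" .
  have "1 \<le> t" using t by simp
  then obtain \<chi> :: "nat set \<Rightarrow> nat" where "range \<chi> \<subseteq> {0, 1}" "\<not> has_ordered_biclique {..<n} \<chi> s t"
    using exists_coloring_without_biclique[OF _ \<Lambda>(1) less] by blast
  then show ?thesis unfolding two_color_arrows_def n_def[symmetric] by blast
qed

theorem theorem1p7:
  fixes s :: nat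
  assumes "s \<ge> 2"
  shows "\<exists>C :: real. C > 0 \<and> (\<exists>t\<^sub>0 :: nat. \<forall>t :: nat. t \<ge> t\<^sub>0 \<longrightarrow>
    r2' (complete_bipartite s t) = CR (complete_bipartite s t) (complete_graph 3) \<and>
    2 ^ s / (real s + 1) * real t - C * sqrt (real t * ln (real t))
      \<le> real (r2' (complete_bipartite s t)) \<and>
    real (r2' (complete_bipartite s t)) \<le> 2 ^ s / (real s + 1) * real t + C)"
proof -
  define q where "q = 2 ^ s / (real s + 1)"
  define K where "K = 2 * sqrt (real s + 1)"
  define C1 where "C1 = q * (real ((s + 1) * s) + 3) + 1"
  \<comment> \<open>Chosen so that \<Delta> at most \<open>\<delta> * t\<close> and \<open>n\<close>
    at least \<open>q * t / 2\<close> give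
    \<open>2 ^ s * \<Delta> \<le> n / (8 * s ^ 3)\<close>.\<close>
  define \<delta> where "\<delta> = 1 / (16 * real s ^ 3 * (real s + 1))"
  have s_real: "real s \<ge> 2" using assms by simp
  have q: "q \<ge> 1" using pow2_ge_Suc by (simp add: q_def)
  have K: "K > 0" by (simp add: K_def)
  have \<delta>: "\<delta> > 0" "\<delta> \<le> 1 / 2"
  proof -
    have "real s ^ 3 \<ge> 1" using s_real by simp
    then have "real s ^ 3 * (real s + 1) \<ge> 1 * 1" using s_real by (intro mult_mono) auto
    then show "\<delta> > 0" "\<delta> \<le> 1 / 2" using s_real by (auto simp: \<delta>_def field_simps)
  qed
  have "eventually (\<lambda>t :: nat. K * sqrt (real t * ln (real t)) \<le> \<delta> * real t \<and> t \<ge> 2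
      \<and> real t > 2 ^ (s * s + s) \<and> real t > 2 * gallai_threshold s) sequentially"
    using eventually_sqrt_ln_le[OF \<delta>(1) K] eventually_ge_at_top[of 2]
      eventually_compose_filterlim[OF eventually_gt_at_top filterlim_real_sequentially]
    by (intro eventually_conj) auto
  then obtain t0 where t0: "\<And>t. t \<ge> t0 \<Longrightarrow> K * sqrt (real t * ln (real t)) \<le> \<delta> * real t \<and> t \<ge> 2
      \<and> real t > 2 ^ (s * s + s) \<and> real t > 2 * gallai_threshold s"
    by (auto simp: eventually_sequentially)
  have main: "r2' (complete_bipartite s t) = CR (complete_bipartite s t) (complete_graph 3) \<and>
    q * real t - q * K * sqrt (real t * ln (real t)) \<le> real (r2' (complete_bipartite s t)) \<and>
    real (r2' (complete_bipartite s t)) \<le> q * real t + C1" if "t \<ge> t0" for t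
  proof -
    define \<Delta> where "\<Delta> = K * sqrt (real t * ln (real t))"
    define n where "n = r2' (complete_bipartite s t)"
    have t: "\<Delta> \<le> \<delta> * real t" "t \<ge> 2" "real t > 2 ^ (s * s + s)" "real t > 2 * gallai_threshold s"
      using t0[OF that] by (auto simp: \<Delta>_def)
    have \<Delta>_half: "\<Delta> \<le> real t / 2"
      using t(1) mult_right_mono[OF \<delta>(2), of "real t"] by simp
    have arrows: "two_color_arrows n s t"
      unfolding n_def r2'_eq by (rule LeastI[of "\<lambda>n. two_color_arrows n s t"], rule two_color_arrows_ceiling)
    have upper: "real n \<le> q * real t + C1"
    proof -
      have "n \<le> nat \<lceil>q * (real t + real ((s + 1) * s) + 3)\<rceil>"
        unfolding n_def r2'_eq q_def by (rule Least_le, rule two_color_arrows_ceiling)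
      moreover have "q * (real t + real ((s + 1) * s) + 3) \<ge> 0" using q by simp
      ultimately have "real n \<le> q * (real t + real ((s + 1) * s) + 3) + 1" by linarith
      then show ?thesis by (simp add: C1_def algebra_simps)
    qed
    have lower: "q * real t - q * \<Delta> \<le> real n"
    proof -
      have "\<Delta> \<le> real t" using \<Delta>_half by simp
      then have "\<not> two_color_arrows (nat \<lfloor>q * (real t - \<Delta>)\<rfloor>) s t"
        using not_two_color_arrows[OF t(2,3)] unfolding q_def \<Delta>_def K_def by blast
      then have "nat \<lfloor>q * (real t - \<Delta>)\<rfloor> < n"
        using two_color_arrows_mono[OF arrows] by (meson not_le)
      then have "q * (real t - \<Delta>) \<le> real n" by linarith
      then show ?thesis by (simp add: algebra_simps)
    qed
    have q_s: "(real s + 1) * q = 2 ^ s" by (simp add: q_def)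
    have half: "q * real t / 2 \<le> real n"
    proof -
      have "q * \<Delta> \<le> q * (real t / 2)" using \<Delta>_half q by (intro mult_left_mono) auto
      then show ?thesis using lower by simp
    qed
    then have "real t / 2 \<le> real n" using mult_right_mono[OF q, of "real t"] by simp
    then have large: "real n > gallai_threshold s" using t(4) by linarith
    \<comment> \<open>The lower bound keeps the unknown \<open>n\<close> within the deficit that
      colorings with three colors tolerate.\<close>
    have dense: "2 ^ s * real t \<le> (real s + 1) * real n + real n / (8 * real s ^ 3)"
    proof -
      have "2 ^ s * \<Delta> \<le> 2 ^ s * (\<delta> * real t)" using t(1) by (intro mult_left_mono) auto
      also have "\<dots> = (q * real t / 2) / (8 * real s ^ 3)"
      proof -
        have "(real s + 1) * \<delta> = 1 / (16 * real s ^ 3)" using s_real by (simp add: \<delta>_def)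
        then have "q * real t * ((real s + 1) * \<delta>) = q * real t / 2 / (8 * real s ^ 3)" by simp
        then show ?thesis unfolding q_s[symmetric] by (simp only: mult_ac)
      qed
      also have "\<dots> \<le> real n / (8 * real s ^ 3)" using half by (intro divide_right_mono) auto
      finally have 1: "2 ^ s * \<Delta> \<le> real n / (8 * real s ^ 3)" .
      have "(real s + 1) * (q * real t - q * \<Delta>) \<le> (real s + 1) * real n"
        using lower by (intro mult_left_mono) auto
      moreover have "(real s + 1) * (q * real t - q * \<Delta>) = 2 ^ s * real t - 2 ^ s * \<Delta>"
        unfolding q_s[symmetric] by (simp add: algebra_simps)
      ultimately show ?thesis using 1 by linarith
    qed
    define P where "P = (\<lambda>n. \<forall>\<chi> :: nat set \<Rightarrow> nat. rainbow_triangle_free {..<n} \<chi> \<longrightarrow> has_ordered_biclique {..<n} \<chi> s t)"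
    have P_n: "P n"
      unfolding P_def
    proof (intro allI impI)
      fix \<chi> :: "nat set \<Rightarrow> nat" assume free: "rainbow_triangle_free {..<n} \<chi>"
      let ?E = "{{x, y} | x y. x \<in> {..<n} \<and> y \<in> {..<n} \<and> x \<noteq> y}"
      show "has_ordered_biclique {..<n} \<chi> s t"
      proof (cases "\<exists>c c'. \<chi> ` ?E \<subseteq> {c, c'}")
        case True
        then obtain c c' where cc: "\<chi> ` ?E \<subseteq> {c, c'}" by blast
        define \<chi>' :: "nat set \<Rightarrow> nat" where "\<chi>' = (\<lambda>e. if \<chi> e = c then 0 else 1)"
        have "has_ordered_biclique {..<n} \<chi>' s t"
          using arrows unfolding two_color_arrows_def by (simp add: \<chi>'_def)
        then show ?thesis
        proof (rule has_ordered_biclique_recolor[where g = "\<lambda>i. if i = 0 then c else c'"])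
          fix x y assume "x \<in> {..<n}" "y \<in> {..<n}" "x \<noteq> y"
          then have "\<chi> {x, y} \<in> {c, c'}" using cc by blast
          then show "\<chi> {x, y} = (if \<chi>' {x, y} = 0 then c else c')" by (auto simp: \<chi>'_def)
        qed simp
      next
        case False
        then show ?thesis
          using three_colors_imp_biclique[OF _ assms free False, of t] dense large by simp
      qed
    qed
    \<comment> \<open>Two colors cannot make a triangle rainbow, so \<open>CR\<close> is at least
      \<open>r2'\<close>.\<close>
    have P_imp: "two_color_arrows m s t" if "P m" for m
      unfolding two_color_arrows_def
    proof (intro allI impI)
      fix \<chi> :: "nat set \<Rightarrow> nat" assume *: "\<forall>x<m. \<forall>y<m. x \<noteq> y \<longrightarrow> \<chi> {x, y} \<in> {0, 1}"
      have "rainbow_triangle_free {..<m} \<chi>"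
        unfolding rainbow_triangle_free_def
      proof (intro ballI impI)
        fix x y z assume "x \<in> {..<m}" "y \<in> {..<m}" "z \<in> {..<m}" "x \<noteq> y \<and> y \<noteq> z \<and> x \<noteq> z"
        then have "\<chi> {x, y} \<in> {0, 1}" "\<chi> {y, z} \<in> {0, 1}" "\<chi> {x, z} \<in> {0, 1}" using * by auto
        then show "\<chi> {x, y} = \<chi> {y, z} \<or> \<chi> {y, z} = \<chi> {x, z} \<or> \<chi> {x, y} = \<chi> {x, z}" by auto
      qed
      then show "has_ordered_biclique {..<m} \<chi> s t" using \<open>P m\<close> by (simp add: P_def)
    qed
    have CR: "CR (complete_bipartite s t) (complete_graph 3) = (LEAST n. P n)"
      unfolding CR_eq P_def ..
    have "(LEAST n. P n) = n"
    proof (rule antisym)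
      show "(LEAST n. P n) \<le> n" using P_n by (rule Least_le)
      show "n \<le> (LEAST n. P n)"
        unfolding n_def r2'_eq by (rule Least_le) (rule P_imp, rule LeastI[of P, OF P_n])
    qed
    then show ?thesis
      using upper lower unfolding CR n_def[symmetric] \<Delta>_def by (simp add: mult.assoc)
  qed
  define C where "C = C1 + q * K"
  have pos: "C1 > 0" "q * K > 0" using q K by (auto simp: C1_def intro!: add_nonneg_pos)
  show ?thesis
  \<comment> \<open>From \<open>t \<ge> 1\<close> on, \<open>t * ln t\<close> and hence its
    \<open>sqrt\<close> are nonnegative, so enlarging the constant only weakens the lower
    bound.\<close>
  proof (intro exI[of _ C] conjI exI[of _ "max t0 1"] allI impI)
    show "C > 0" using pos by (simp add: C_def)
    fix t assume t: "max t0 1 \<le> t"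
    have m: "r2' (complete_bipartite s t) = CR (complete_bipartite s t) (complete_graph 3) \<and>
      q * real t - q * K * sqrt (real t * ln (real t)) \<le> real (r2' (complete_bipartite s t)) \<and>
      real (r2' (complete_bipartite s t)) \<le> q * real t + C1" using main[of t] t by simp
    then show "r2' (complete_bipartite s t) = CR (complete_bipartite s t) (complete_graph 3)" by blast
    have "q * K * sqrt (real t * ln (real t)) \<le> C * sqrt (real t * ln (real t))"
      using pos t by (intro mult_right_mono) (auto simp: C_def)
    then show "2 ^ s / (real s + 1) * real t - C * sqrt (real t * ln (real t))
        \<le> real (r2' (complete_bipartite s t))"
      using m unfolding q_def[symmetric] by linarith
    show "real (r2' (complete_bipartite s t)) \<le> 2 ^ s / (real s + 1) * real t + C"
      using m pos unfolding q_def[symmetric] C_def by linarith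
  qed
qed

end
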